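(* Let $f(x)=\mathbb{E}_\xi[f(x,\xi)]$ be convex and $L_0$-Lipschitz continuous on $\mathbb{R}^d$, with minimizer $x^*$, and suppose that $\mathbb{E}_\xi[(f(x,\xi)-f(x))^2]\le\sigma_0^2$ for all $x\in\mathbb{R}^d$, where $\sigma_0>0$. Run the stochastic one-point residual feedback algorithm from $x_1$ for $T$ iterations with $$\eta=\frac{\|x_1-x^*\|\,\alpha}{(24dT)^{1/2}(c_0L_0^2\alpha^2+d\sigma_0^2)^{1/2}},\qquad \alpha=\frac{(96)^{1/4}d^{1/2}\sigma_0^{1/2}\|x_1-x^*\|^{1/2}}{L_0^{1/2}T^{1/4}} .$$ Let $\varepsilon>0$. If $T\ge\frac{3L_0^2\|x_1-x^*\|^2}{2^{11}\,c_0^2\sigma_0^2}$, then to find an $\varepsilon$-suboptimal solution the sample complexity of the algorithm is $$T=96L_0^2\|x_1-x^*\|^2\cdot\max\left(\frac{16d^2\sigma_0^2}{\varepsilon^4},\ \frac{dc_0}{\varepsilon^2}\right),$$ that is, $\frac1T\sum_{t=1}^T\mathbb{E}[f(x_t)-f(x^* )]\le\varepsilon$ whenever $T$ satisfies the condition above and is at least this quantity.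
   Context: $\|\cdot\|$ is the Euclidean norm on $\mathbb{R}^d$, $d\ge1$. A function $f$ is $L_0$-Lipschitz continuous ($L_0>0$) if $|f(x)-f(y)|\le L_0\|x-y\|$ for all $x,y$. $\xi$ is a random variable and $f(\cdot,\xi)$ is the random objective. $x^*$ denotes a minimizer of $f$ over $\mathbb{R}^d$. $c_0>0$ is a fixed universal numerical constant such that for every $d\ge1$, every $M>0$ and every $M$-Lipschitz function $h:\mathbb{R}^d\to\mathbb{R}$, if $u$ is uniformly distributed on the Euclidean unit sphere of $\mathbb{R}^d$ then $\sqrt{\mathbb{E}[(h(u)-\mathbb{E}[h(u)])^4]}\le c_0M^2/d$. Stochastic one-point residual feedback algorithm: given $x_1\in\mathbb{R}^d$, step size $\eta>0$, smoothing parameter $\alpha>0$ and iteration number $T$, set $x_0=x_1$, let $u_0,\dots,u_T$ be independent and uniformly distributed on the unit sphere of $\mathbb{R}^d$, let $\xi_0,\dots,\xi_T$ be independent copies of $\xi$, independent of the $u_t$, and for $t=1,\dots,T$ put $$\tilde g_t=d\cdot\frac{f(x_t+\alpha u_t,\xi_t)-f(x_{t-1}+\alpha u_{t-1},\xi_{t-1})}{\alpha}\,u_t,\qquad x_{t+1}=x_t-\eta\tilde g_t .$$ Each iteration uses one new function evaluation, so the number of iterations is the sample complexity. Expectations $\mathbb{E}$ are over all the $u_t,\xi_t$. *)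

theory Defs
  imports "HOL-Probability.Probability"
begin

text \<open>
  The uniform distribution on the unit sphere is the image of the uniform distribution on the
  open unit ball under the radial projection \<open>x \<mapsto> x / \<parallel>x\<parallel>\<close> (normalised cone measure, which on
  the Euclidean sphere is the normalised surface measure). The projection \<open>sgn\<close> sends the
  null set \<open>{0}\<close> to \<open>0\<close>.
\<close>

definition unif_sphere :: "(real ^ 'n) measure" where
  "unif_sphere = distr (uniform_measure lborel (ball 0 1)) borel sgn"

text \<open>
  The constant \<open>c\<^sub>0\<close> is quantified over all dimensions at once, which cannot be said with
  dimensions that are types. For this purpose only, vectors of \<open>\<real>\<^sup>d\<close> are represented as
  elements of \<open>{..<d} \<rightarrow>\<^sub>E UNIV\<close>, with \<open>L2_set\<close> as Euclidean norm; the type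
  \<open>nat \<Rightarrow> real\<close> has its own unrelated metric, so the Lipschitz condition is spelled out.
\<close>

definition coord_unif_sphere :: "nat \<Rightarrow> (nat \<Rightarrow> real) measure" where
  "coord_unif_sphere d =
     distr
       (uniform_measure (\<Pi>\<^sub>M i\<in>{..<d}. lborel) {x \<in> {..<d} \<rightarrow>\<^sub>E UNIV. L2_set x {..<d} < 1})
       (\<Pi>\<^sub>M i\<in>{..<d}. borel)
       (\<lambda>x. \<lambda>i\<in>{..<d}. x i / L2_set x {..<d})"

definition coord_lipschitz :: "nat \<Rightarrow> real \<Rightarrow> ((nat \<Rightarrow> real) \<Rightarrow> real) \<Rightarrow> bool" where
  "coord_lipschitz d M h \<longleftrightarrow>
     (\<forall>x \<in> {..<d} \<rightarrow>\<^sub>E UNIV. \<forall>y \<in> {..<d} \<rightarrow>\<^sub>E UNIV.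
        \<bar>h x - h y\<bar> \<le> M * L2_set (\<lambda>i. x i - y i) {..<d})"

definition sphere_fourth_moment_const :: "real \<Rightarrow> bool" where
  "sphere_fourth_moment_const c \<longleftrightarrow>
     (\<forall>d\<ge>1. \<forall>M>0. \<forall>h. coord_lipschitz d M h \<longrightarrow>
        sqrt (\<integral>u. (h u - (\<integral>v. h v \<partial>coord_unif_sphere d)) ^ 4 \<partial>coord_unif_sphere d)
          \<le> c * M\<^sup>2 / real d)"

definition residual_gradient ::
  "(real ^ 'n \<Rightarrow> 'b \<Rightarrow> real) \<Rightarrow> real \<Rightarrow> real ^ 'n \<Rightarrow> real ^ 'n \<Rightarrow> 'b
    \<Rightarrow> real ^ 'n \<Rightarrow> real ^ 'n \<Rightarrow> 'b \<Rightarrow> real ^ 'n" where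
  "residual_gradient F \<alpha> x u z x' u' z' =
     (real CARD('n) * ((F (x + \<alpha> *\<^sub>R u) z - F (x' + \<alpha> *\<^sub>R u') z') / \<alpha>)) *\<^sub>R u"

text \<open>
  The iterates along one realisation \<open>u\<close>, \<open>z\<close> of the directions and of the noise; indices
  \<open>0\<close> and \<open>1\<close> both carry the starting point.
\<close>

fun residual_iterate ::
  "(real ^ 'n \<Rightarrow> 'b \<Rightarrow> real) \<Rightarrow> real \<Rightarrow> real \<Rightarrow> real ^ 'n
    \<Rightarrow> (nat \<Rightarrow> real ^ 'n) \<Rightarrow> (nat \<Rightarrow> 'b) \<Rightarrow> nat \<Rightarrow> real ^ 'n" where
  "residual_iterate F \<eta> \<alpha> x1 u z 0 = x1"
| "residual_iterate F \<eta> \<alpha> x1 u z (Suc 0) = x1"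
| "residual_iterate F \<eta> \<alpha> x1 u z (Suc (Suc t)) =
     residual_iterate F \<eta> \<alpha> x1 u z (Suc t) -
     \<eta> *\<^sub>R residual_gradient F \<alpha>
           (residual_iterate F \<eta> \<alpha> x1 u z (Suc t)) (u (Suc t)) (z (Suc t))
           (residual_iterate F \<eta> \<alpha> x1 u z t) (u t) (z t)"

end

theory Submission
  imports Defs
begin

text \<open>
  The method is stochastic gradient descent. Let \<open>n\<close> be the dimension, \<open>D\<close> the distance of the starting
  point from the minimizer \<open>a\<close>, \<open>x\<^sub>t\<close> the iterates, \<open>y\<^sub>t\<close> the noisy value observed at
  \<open>x\<^sub>t + \<alpha> u\<^sub>t\<close>, and \<open>h x\<close> the mean of \<open>f (x + \<alpha> u)\<close> over the sphere. Two facts carry the proof.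

  The estimate points in the right direction. By the divergence theorem, \<open>n / \<alpha>\<close> times the spherical
  mean of \<open>f (x + \<alpha> u) u\<close> is the gradient of the mean of \<open>f\<close> over a ball of radius \<open>\<alpha>\<close>. For
  convex \<open>f\<close> its inner product with \<open>x - a\<close> is therefore at least \<open>f x - f a - \<alpha> L\<close>. This is
  \<open>sphere_gradient_inequality\<close>; its proof avoids surface integrals and differentiability of \<open>f\<close> by
  smoothing the indicator of the ball and using that the Lebesgue measure is invariant under translations.
  The previous observation \<open>y\<^sub>t\<^sub>-\<^sub>1\<close>, which the algorithm subtracts, is independent of the new
  direction, and the direction has mean zero; so it leaves the conditional mean unchanged.

  The estimate is not too large. The residual is
  \<open>(y\<^sub>t - h x\<^sub>t) - (y\<^sub>t\<^sub>-\<^sub>1 - h x\<^sub>t\<^sub>-\<^sub>1) + (h x\<^sub>t - h x\<^sub>t\<^sub>-\<^sub>1)\<close>. Each of the first two terms has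
  second moment at most \<open>V = \<sigma>\<^sup>2 + c L\<^sup>2 \<alpha>\<^sup>2 / n\<close> (\<open>evaluation_second_moment\<close>), and the last is at
  most \<open>L\<close> times the preceding displacement. With the gain \<open>\<gamma> = \<eta> n / \<alpha>\<close> the second moments \<open>b\<^sub>t\<close> of
  the displacements thus satisfy \<open>b\<^sub>t \<le> \<gamma>\<^sup>2 (6 V + 3 L\<^sup>2 b\<^sub>t\<^sub>-\<^sub>1)\<close>. For the given step size
  \<open>6 \<gamma>\<^sup>2 V = D\<^sup>2 / (4 T)\<close>, and the first lower bound on \<open>T\<close> yields \<open>3 \<gamma>\<^sup>2 L\<^sup>2 \<le> 1 / 3\<close>; hence
  \<open>b\<^sub>t \<le> 3/8 D\<^sup>2 / T\<close> for all \<open>t\<close> (\<open>displacement_second_moment\<close>).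

  Summing the expansion of the squared distances to \<open>a\<close> over \<open>t\<close> bounds the average
  suboptimality by \<open>\<alpha> L + 11/16 D\<^sup>2 / (\<eta> T)\<close>. For \<open>T\<close> above the stated complexity the first term is
  at most \<open>\<epsilon> / 2\<close> and \<open>D\<^sup>2 / (\<eta> T)\<close> at most \<open>9/16 \<epsilon>\<close>, which together stays below \<open>\<epsilon>\<close>.
\<close>

section \<open>The uniform distribution on the sphere\<close>

declare borel_measurable_indicator [OF borel_open [OF open_ball], measurable]

lemma lborel_integral_affine:
  fixes \<phi> :: "'a::euclidean_space \<Rightarrow> real"
  assumes "c \<noteq> 0" and [measurable]: "\<phi> \<in> borel_measurable borel"
  shows "(\<integral>v. \<phi> v \<partial>lborel) = \<bar>c\<bar> ^ DIM('a) * (\<integral>v. \<phi> (t + c *\<^sub>R v) \<partial>lborel)"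
  by (subst lborel_affine[OF assms(1), of t]) (simp add: integral_density integral_distr)

lemma integrable_continuous_bounded_support:
  fixes k :: "'a::euclidean_space \<Rightarrow> real"
  assumes "continuous_on UNIV k" and "\<And>v. norm v \<ge> R \<Longrightarrow> k v = 0"
  shows "integrable lborel k"
proof -
  have "integrable lborel (\<lambda>v. indicator (cball 0 R) v *\<^sub>R k v)"
    by (rule borel_integrable_compact) (auto intro: continuous_on_subset[OF assms(1)])
  also have "(\<lambda>v. indicator (cball 0 R) v *\<^sub>R k v) = k"
    using assms(2) by (auto simp: indicator_def fun_eq_iff)
  finally show ?thesis .
qed

lemma lipschitz_on_borel_measurable:
  fixes g :: "'a::euclidean_space \<Rightarrow> real"
  assumes "K-lipschitz_on UNIV g"
  shows "g \<in> borel_measurable borel"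
  by (rule borel_measurable_continuous_onI) (rule lipschitz_on_continuous_on[OF assms])

lemma lipschitz_on_abs_diff_le:
  fixes g :: "'a::euclidean_space \<Rightarrow> real"
  assumes "K-lipschitz_on UNIV g"
  shows "\<bar>g v - g v'\<bar> \<le> K * norm (v - v')"
  using lipschitz_onD[OF assms, of v v'] by (simp add: dist_norm)

abbreviation unit_ball_volume :: "'n::finite itself \<Rightarrow> real" where
  "unit_ball_volume _ \<equiv> measure lborel (ball (0 :: real ^ 'n) 1)"

lemma unit_ball_volume_pos: "unit_ball_volume TYPE('n::finite) > 0"
  using content_ball_pos[of 1 "0 :: real ^ 'n"] by (auto simp: measure_def)

lemma prob_space_unif_sphere: "prob_space (unif_sphere :: (real ^ 'n) measure)"
proof -
  have *: "prob_space (uniform_measure lborel (ball (0 :: real ^ 'n) 1))"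
  proof (rule prob_space_uniform_measure)
    show "emeasure lborel (ball (0 :: real ^ 'n) 1) \<noteq> 0"
      using unit_ball_volume_pos[where 'n = 'n] by (auto simp: measure_def)
  qed (use emeasure_lborel_ball_finite[of "0 :: real ^ 'n" 1] in auto)
  show ?thesis
    unfolding unif_sphere_def by (rule prob_space.prob_space_distr[OF *]) simp
qed

lemma sets_unif_sphere [measurable_cong, simp]: "sets unif_sphere = sets borel"
  by (simp add: unif_sphere_def)

lemma space_unif_sphere [simp]: "space unif_sphere = UNIV"
  by (simp add: unif_sphere_def)

lemma integral_unif_sphere:
  fixes \<phi> :: "real ^ 'n \<Rightarrow> real"
  assumes [measurable]: "\<phi> \<in> borel_measurable borel"
  shows "(\<integral>u. \<phi> u \<partial>unif_sphere) =
    (\<integral>v. indicator (ball 0 1) v * \<phi> (sgn v) \<partial>lborel) / unit_ball_volume TYPE('n)"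
proof -
  let ?B = "ball (0 :: real ^ 'n) 1"
  have pos: "measure lborel ?B > 0"
    by (rule unit_ball_volume_pos)
  have em: "emeasure lborel ?B = ennreal (measure lborel ?B)"
    using emeasure_lborel_ball_finite[of "0 :: real ^ 'n" 1]
    by (simp add: emeasure_eq_ennreal_measure)
  have "(\<lambda>x. indicator ?B x / emeasure lborel ?B)
      = (\<lambda>x. ennreal (indicator ?B x / measure lborel ?B))"
    unfolding em using pos by (auto simp: fun_eq_iff indicator_def ennreal_1[symmetric] divide_ennreal simp del: ennreal_1)
  then have "uniform_measure lborel ?B = density lborel (\<lambda>x. ennreal (indicator ?B x / measure lborel ?B))"
    by (simp add: uniform_measure_def)
  then show ?thesis
    unfolding unif_sphere_def
    by (simp add: integral_distr integral_density)
qed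

lemma AE_unif_sphere_norm: "AE u in (unif_sphere :: (real ^ 'n) measure). norm u = 1"
proof -
  have "AE v in (lborel :: (real ^ 'n) measure). v \<noteq> 0"
    by (rule AE_lborel_singleton)
  then have "AE v in uniform_measure lborel (ball (0 :: real ^ 'n) 1). norm (sgn v) = 1"
    by (intro AE_uniform_measureI) (auto simp: norm_sgn)
  then show ?thesis
    unfolding unif_sphere_def by (subst AE_distr_iff) auto
qed

text \<open>
  The reflection \<open>v \<mapsto> - v\<close> preserves the ball and reverses the integrand.
\<close>

lemma integral_unif_sphere_inner:
  "(\<integral>u. u \<bullet> w \<partial>(unif_sphere :: (real ^ 'n) measure)) = 0"
proof -
  let ?\<phi> = "\<lambda>v :: real ^ 'n. indicator (ball 0 1) v * (sgn v \<bullet> w)"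
  have "(\<integral>v. ?\<phi> v \<partial>lborel) = (\<integral>v. ?\<phi> (- v) \<partial>lborel)"
    by (subst lborel_integral_affine[of "-1" _ 0]) simp_all
  also have "\<dots> = - (\<integral>v. ?\<phi> v \<partial>lborel)"
    by (simp add: sgn_minus indicator_def flip: integral_minus)
  finally show ?thesis
    by (subst integral_unif_sphere) auto
qed

lemma integrable_unif_sphere:
  fixes g :: "real ^ 'n \<Rightarrow> real"
  assumes [measurable]: "g \<in> borel_measurable borel" and "\<And>u. norm u = 1 \<Longrightarrow> \<bar>g u\<bar> \<le> C"
  shows "integrable unif_sphere g"
proof -
  interpret prob_space "unif_sphere :: (real ^ 'n) measure" by (rule prob_space_unif_sphere)
  show ?thesis
    by (rule integrable_const_bound[of _ C]) (use AE_unif_sphere_norm assms(2) in \<open>auto\<close>)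
qed

text \<open>
  A function of \<open>sgn v\<close> is constant along rays, so that dilating the unit ball to radius \<open>r\<close> only
  produces the Jacobian. The shell version below follows by taking the difference of two balls; it is
  how thin shells are compared with the sphere.
\<close>

lemma integral_ball_radial_projection:
  fixes \<phi> :: "real ^ 'n \<Rightarrow> real"
  assumes [measurable]: "\<phi> \<in> borel_measurable borel" and "r > 0"
  shows "(\<integral>v. indicator (ball 0 r) v * \<phi> (sgn v) \<partial>lborel) =
    r ^ CARD('n) * unit_ball_volume TYPE('n) * (\<integral>u. \<phi> u \<partial>unif_sphere)"
proof -
  have "(\<integral>v. indicator (ball 0 r) v * \<phi> (sgn v) \<partial>lborel) =
     r ^ CARD('n) * (\<integral>v. indicator (ball 0 r) (r *\<^sub>R v) * \<phi> (sgn (r *\<^sub>R v)) \<partial>lborel)"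
    using \<open>r > 0\<close> by (subst lborel_integral_affine[of r _ 0]) simp_all
  also have "(\<lambda>v::real^'n. indicator (ball 0 r) (r *\<^sub>R v) * \<phi> (sgn (r *\<^sub>R v))) =
      (\<lambda>v. indicator (ball 0 1) v * \<phi> (sgn v))"
    using \<open>r > 0\<close> by (auto simp: fun_eq_iff indicator_def sgn_scaleR)
  finally show ?thesis
    using unit_ball_volume_pos[where 'n = 'n] by (simp add: integral_unif_sphere)
qed

lemma integrable_bounded_on_bounded:
  fixes k :: "'a::euclidean_space \<Rightarrow> real"
  assumes [measurable]: "k \<in> borel_measurable borel"
    and "\<And>v. \<bar>k v\<bar> \<le> C * indicator (cball 0 R) v"
  shows "integrable lborel k"
proof (rule Bochner_Integration.integrable_bound)
  show "integrable lborel (\<lambda>v :: 'a. C * indicator (cball 0 R) v :: real)"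
    using emeasure_lborel_cball_finite[of "0 :: 'a" R]
    by (intro integrable_mult_right integrable_real_indicator) (auto simp: top_unique)
  show "AE v in lborel. norm (k v) \<le> norm (C * indicator (cball 0 R) v :: real)"
    using assms(2) by (intro AE_I2) (auto intro: order_trans abs_ge_self)
qed simp

lemma integral_shell_radial_projection:
  fixes \<phi> :: "real ^ 'n \<Rightarrow> real"
  assumes [measurable]: "\<phi> \<in> borel_measurable borel" and "\<delta> > 0"
    and "\<And>u. norm u \<le> 1 \<Longrightarrow> \<bar>\<phi> u\<bar> \<le> C"
  shows "(\<integral>v. indicator (ball 0 (1 + \<delta>) - ball 0 1) v * \<phi> (sgn v) \<partial>lborel) =
    ((1 + \<delta>) ^ CARD('n) - 1) * unit_ball_volume TYPE('n) * (\<integral>u. \<phi> u \<partial>unif_sphere)"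
proof -
  have C: "\<bar>\<phi> (sgn v)\<bar> \<le> C" for v
    by (rule assms(3)) (simp add: norm_sgn)
  have int: "integrable lborel (\<lambda>v. indicator (ball 0 r) v * \<phi> (sgn v))" for r
    using C by (intro integrable_bounded_on_bounded[of _ C r])
      (auto simp: indicator_def intro: order_trans[OF abs_ge_zero C])
  have "(\<lambda>v. indicator (ball 0 (1 + \<delta>) - ball 0 1) v * \<phi> (sgn v)) =
     (\<lambda>v. indicator (ball 0 (1 + \<delta>)) v * \<phi> (sgn v) - indicator (ball 0 1) v * \<phi> (sgn v))"
    using \<open>\<delta> > 0\<close> by (auto simp: fun_eq_iff indicator_def)
  then show ?thesis
    using \<open>\<delta> > 0\<close> integral_ball_radial_projection[OF assms(1), of 1]
      integral_ball_radial_projection[OF assms(1), of "1 + \<delta>"]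
    by (simp only: Bochner_Integration.integral_diff[OF int int]) (simp add: integral_ball_radial_projection algebra_simps)
qed

section \<open>A gradient inequality for spherical averages of convex functions\<close>

text \<open>
  A Lipschitz cut-off: \<open>1\<close> on the unit ball, \<open>0\<close> outside the ball of radius \<open>1 + \<delta>\<close>, and radially
  affine on the shell between them, so that its gradient there is \<open>- sgn v / \<delta>\<close>.
\<close>

definition plateau :: "real \<Rightarrow> 'a::euclidean_space \<Rightarrow> real" where
  "plateau \<delta> v = max 0 (min 1 ((1 + \<delta> - norm v) / \<delta>))"

lemma plateau_nonneg: "0 \<le> plateau \<delta> v" and plateau_le_1: "plateau \<delta> v \<le> 1"
  by (auto simp: plateau_def)

lemma plateau_inside: "\<delta> > 0 \<Longrightarrow> norm v \<le> 1 \<Longrightarrow> plateau \<delta> v = 1"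
  by (auto simp: plateau_def field_simps min_def max_def)

lemma plateau_outside: "\<delta> > 0 \<Longrightarrow> norm v \<ge> 1 + \<delta> \<Longrightarrow> plateau \<delta> v = 0"
  by (auto simp: plateau_def field_simps min_def max_def)

lemma plateau_minus [simp]: "plateau \<delta> (- v) = plateau \<delta> v"
  by (simp add: plateau_def)

lemma continuous_plateau: "\<delta> > 0 \<Longrightarrow> continuous_on S (plateau \<delta>)"
  unfolding plateau_def by (intro continuous_intros) auto

lemma plateau_lipschitz:
  assumes "\<delta> > 0" shows "\<bar>plateau \<delta> v - plateau \<delta> v'\<bar> \<le> norm (v - v') / \<delta>"
proof -
  have "\<bar>plateau \<delta> v - plateau \<delta> v'\<bar> \<le> \<bar>(1 + \<delta> - norm v) / \<delta> - (1 + \<delta> - norm v') / \<delta>\<bar>"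
    unfolding plateau_def by linarith
  also have "\<dots> = \<bar>norm v' - norm v\<bar> / \<delta>"
    using assms by (simp add: diff_divide_distrib[symmetric])
  also have "\<dots> \<le> norm (v - v') / \<delta>"
    using assms norm_triangle_ineq3[of v v'] by (intro divide_right_mono) auto
  finally show ?thesis .
qed

text \<open>
  The two spheres on which the cut-off is not differentiable are excluded; they are null sets.
\<close>

lemma plateau_difference_quotient:
  fixes v w :: "'a::euclidean_space"
  assumes \<delta>: "\<delta> > 0" and v: "norm v \<noteq> 1" "norm v \<noteq> 1 + \<delta>"
  shows "(\<lambda>i. (plateau \<delta> v - plateau \<delta> (v + inverse (real (Suc i)) *\<^sub>R w)) / inverse (real (Suc i)))
    \<longlonglongrightarrow> indicator (ball 0 (1 + \<delta>) - ball 0 1) v * (sgn v \<bullet> w) / \<delta>"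
proof -
  let ?s = "\<lambda>i. inverse (real (Suc i))"
  have s0: "?s \<longlonglongrightarrow> 0"
    by (rule LIMSEQ_inverse_real_of_nat)
  have norm_lim: "(\<lambda>i. norm (v + ?s i *\<^sub>R w)) \<longlonglongrightarrow> norm v"
    using tendsto_norm[OF tendsto_add[OF tendsto_const tendsto_scaleR[OF s0 tendsto_const]], of v w] by simp
  consider "norm v < 1" | "norm v > 1 + \<delta>" | "1 < norm v" "norm v < 1 + \<delta>"
    using v by linarith
  then show ?thesis
  proof cases
    case 1
    have "eventually (\<lambda>i. norm (v + ?s i *\<^sub>R w) < 1) sequentially"
      using order_tendstoD(2)[OF norm_lim 1] .
    then have "eventually (\<lambda>i. (plateau \<delta> v - plateau \<delta> (v + ?s i *\<^sub>R w)) / ?s i = 0) sequentially"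
      by eventually_elim (use 1 \<delta> in \<open>simp add: plateau_inside\<close>)
    then show ?thesis
      using 1 \<delta> by (auto intro: tendsto_eventually)
  next
    case 2
    have "eventually (\<lambda>i. norm (v + ?s i *\<^sub>R w) > 1 + \<delta>) sequentially"
      using order_tendstoD(1)[OF norm_lim 2] .
    then have "eventually (\<lambda>i. (plateau \<delta> v - plateau \<delta> (v + ?s i *\<^sub>R w)) / ?s i = 0) sequentially"
      by eventually_elim (use 2 \<delta> in \<open>simp add: plateau_outside\<close>)
    then show ?thesis
      using 2 \<delta> by (auto intro: tendsto_eventually)
  next
    case 3
    then have "v \<noteq> 0" by auto
    \<comment> \<open>on the open shell the norm is differentiable with gradient \<open>sgn v\<close>\<close>
    have "((\<lambda>s. v + s *\<^sub>R w) has_derivative (\<lambda>s. s *\<^sub>R w)) (at 0)"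
      by (auto intro!: derivative_eq_intros)
    moreover have "(norm has_derivative (\<lambda>h. h \<bullet> sgn v)) (at (v + 0 *\<^sub>R w))"
      using has_derivative_norm[OF \<open>v \<noteq> 0\<close>] by simp
    ultimately have "((\<lambda>s. norm (v + s *\<^sub>R w)) has_derivative (\<lambda>s. (s *\<^sub>R w) \<bullet> sgn v)) (at 0)"
      by (rule has_derivative_compose)
    moreover have "(\<lambda>s. (s *\<^sub>R w) \<bullet> sgn v) = (*) (sgn v \<bullet> w)"
      by (simp add: fun_eq_iff inner_commute mult.commute)
    ultimately have "((\<lambda>s. norm (v + s *\<^sub>R w)) has_real_derivative (sgn v \<bullet> w)) (at 0)"
      by (simp add: has_field_derivative_def)
    then have "(\<lambda>s. (norm (v + s *\<^sub>R w) - norm v) / s) \<midarrow>0\<rightarrow> sgn v \<bullet> w"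
      by (simp add: DERIV_def)
    moreover have "filterlim ?s (at 0) sequentially"
      using s0 by (auto simp: filterlim_at)
    ultimately have "(\<lambda>i. (norm (v + ?s i *\<^sub>R w) - norm v) / ?s i) \<longlonglongrightarrow> sgn v \<bullet> w"
      by (rule filterlim_compose)
    from tendsto_divide[OF this tendsto_const[of \<delta>]]
    have lim: "(\<lambda>i. (norm (v + ?s i *\<^sub>R w) - norm v) / ?s i / \<delta>) \<longlonglongrightarrow> (sgn v \<bullet> w) / \<delta>"
      using \<delta> by simp
    have in_shell: "plateau \<delta> v' = (1 + \<delta> - norm v') / \<delta>" if "1 < norm v'" "norm v' < 1 + \<delta>" for v' :: 'a
      using that \<delta> by (auto simp: plateau_def field_simps min_def max_def)
    have "eventually (\<lambda>i. norm (v + ?s i *\<^sub>R w) > 1) sequentially"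
      "eventually (\<lambda>i. norm (v + ?s i *\<^sub>R w) < 1 + \<delta>) sequentially"
      using order_tendstoD[OF norm_lim] 3 by auto
    then have "eventually (\<lambda>i. (norm (v + ?s i *\<^sub>R w) - norm v) / ?s i / \<delta> =
      (plateau \<delta> v - plateau \<delta> (v + ?s i *\<^sub>R w)) / ?s i) sequentially"
    proof eventually_elim
      case (elim i)
      have "(a - b) / s / \<delta> = ((1 + \<delta> - b) / \<delta> - (1 + \<delta> - a) / \<delta>) / s" for a b s :: real
        by (simp add: diff_divide_distrib[symmetric] mult.commute)
      then show ?case
        by (simp only: in_shell[OF 3] in_shell[OF elim])
    qed
    from Lim_transform_eventually[OF lim this] show ?thesis
      using 3 by (simp add: indicator_def)
  qed
qed

text \<open>
  The dominating function for the limit of the difference quotients: they are bounded by the Lipschitz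
  constant and vanish once \<open>v\<close> is so far out that a step of length at most \<open>norm w\<close> cannot
  reach the support.
\<close>

lemma plateau_quotient_le:
  fixes v w :: "'a::euclidean_space"
  assumes \<delta>: "\<delta> > 0" and s: "0 < s" "s \<le> 1"
  shows "\<bar>(plateau \<delta> v - plateau \<delta> (v + s *\<^sub>R w)) / s\<bar> \<le> norm w / \<delta> * indicator (cball 0 (1 + \<delta> + norm w)) v"
proof (cases "norm v \<le> 1 + \<delta> + norm w")
  case True
  have "\<bar>plateau \<delta> v - plateau \<delta> (v + s *\<^sub>R w)\<bar> \<le> norm w / \<delta> * s"
    using plateau_lipschitz[OF \<delta>, of v "v + s *\<^sub>R w"] s by (simp add: mult.commute)
  then show ?thesis
    using s True by (simp add: pos_divide_le_eq)
next
  case False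
  have "norm (s *\<^sub>R w) \<le> norm w"
    using s mult_right_mono[of s 1 "norm w"] by simp
  then have "1 + \<delta> \<le> norm (v + s *\<^sub>R w)" "1 + \<delta> \<le> norm v"
    using False norm_triangle_ineq4[of "v + s *\<^sub>R w" "s *\<^sub>R w"] norm_ge_zero[of w]
    by (simp_all only: add_diff_cancel)
  then show ?thesis
    using \<delta> by (simp add: plateau_outside)
qed

lemma AE_lborel_norm_neq: "AE v in (lborel :: 'a::euclidean_space measure). norm v \<noteq> r"
proof -
  have "sphere (0 :: 'a) r \<in> null_sets lborel"
    using negligible_sphere[of "0 :: 'a" r]
    by (auto simp: null_sets_completion_iff negligible_iff_null_sets)
  from AE_not_in[OF this] show ?thesis by simp
qed

text \<open>
  Integration by parts for a convex function, in a form that uses no derivative of it. Convexity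
  bounds \<open>g v - g (v - w)\<close> by the difference quotient of \<open>g\<close> with step \<open>s \<le> 1\<close> in direction \<open>- w\<close>.
  Translation invariance of the Lebesgue measure moves the difference from \<open>g\<close> to the cut-off, and
  letting \<open>s\<close> tend to \<open>0\<close> leaves the derivative of the cut-off, which lives on the shell.
\<close>

lemma convex_plateau_shell_inequality:
  fixes g :: "'a::euclidean_space \<Rightarrow> real"
  assumes convex: "convex_on UNIV g" and lip: "K-lipschitz_on UNIV g" and \<delta>: "\<delta> > 0"
  shows "(\<integral>v. (g v - g (v - w)) * plateau \<delta> v \<partial>lborel) \<le>
    (\<integral>v. indicator (ball 0 (1 + \<delta>) - ball 0 1) v * (g v * (sgn v \<bullet> w)) \<partial>lborel) / \<delta>"
proof -
  define A :: "'a set" where "A = ball 0 (1 + \<delta>) - ball 0 1"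
  have [measurable]: "A \<in> sets borel" by (simp add: A_def)
  let ?s = "\<lambda>i. inverse (real (Suc i))"
  have s: "0 < ?s i" "?s i \<le> 1" for i by (auto simp: field_simps)
  note [continuous_intros] = continuous_on_compose2[OF lipschitz_on_continuous_on[OF lip]]
    continuous_on_compose2[OF continuous_plateau[OF \<delta>, of UNIV]]
  have [measurable]: "g \<in> borel_measurable borel" by (rule lipschitz_on_borel_measurable[OF lip])
  have [measurable]: "plateau \<delta> \<in> borel_measurable (borel :: 'a measure)"
    by (rule borel_measurable_continuous_onI) (rule continuous_plateau[OF \<delta>])
  let ?q = "\<lambda>i v. (plateau \<delta> v - plateau \<delta> (v + ?s i *\<^sub>R w)) / ?s i"
  define R where "R = 1 + \<delta> + norm w"
  define C where "C = (\<bar>g 0\<bar> + K * R) * (norm w / \<delta>)"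
  have K: "K \<ge> 0" using lip by (rule lipschitz_on_nonneg)
  have int1: "integrable lborel (\<lambda>v :: 'a. g v * plateau \<delta> v)"
    by (rule integrable_continuous_bounded_support[of _ "1 + \<delta>"])
      (auto intro!: continuous_intros simp: plateau_outside \<delta>)
  have int2: "integrable lborel (\<lambda>v :: 'a. g (v - y) * plateau \<delta> v)" for y
    by (rule integrable_continuous_bounded_support[of _ "1 + \<delta>"])
      (auto intro!: continuous_intros simp: plateau_outside \<delta>)
  have int3: "integrable lborel (\<lambda>v. g v * plateau \<delta> (v + y))" for y :: 'a
  proof (rule integrable_continuous_bounded_support[of _ "1 + \<delta> + norm y"])
    fix v :: 'a assume "1 + \<delta> + norm y \<le> norm v"
    then have "1 + \<delta> \<le> norm (v + y)" using norm_triangle_ineq4[of "v + y" y] by simp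
    then show "g v * plateau \<delta> (v + y) = 0" by (simp add: plateau_outside \<delta>)
  qed (auto intro!: continuous_intros)
  have step: "(\<integral>v. (g v - g (v - w)) * plateau \<delta> v \<partial>lborel) \<le> (\<integral>v. g v * ?q i v \<partial>lborel)" for i
  proof -
    have shift: "(\<integral>v. g (v - ?s i *\<^sub>R w) * plateau \<delta> v \<partial>lborel) = (\<integral>v. g v * plateau \<delta> (v + ?s i *\<^sub>R w) \<partial>lborel)"
      by (subst lborel_integral_affine[of 1 _ "?s i *\<^sub>R w"]) (simp_all add: add.commute)
    have "(\<integral>v. (g v - g (v - w)) * plateau \<delta> v \<partial>lborel) \<le>
      (\<integral>v. (g v - g (v - ?s i *\<^sub>R w)) * plateau \<delta> v / ?s i \<partial>lborel)"
    proof (rule integral_mono)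
      show "integrable lborel (\<lambda>v. (g v - g (v - w)) * plateau \<delta> v)"
        using int1 int2[of w] by (simp add: left_diff_distrib)
      show "integrable lborel (\<lambda>v. (g v - g (v - ?s i *\<^sub>R w)) * plateau \<delta> v / ?s i)"
        using int1 int2[of "?s i *\<^sub>R w"] by (simp only: left_diff_distrib) (intro integrable_divide Bochner_Integration.integrable_diff)
      fix v
      have "g ((1 - ?s i) *\<^sub>R v + ?s i *\<^sub>R (v - w)) \<le> (1 - ?s i) * g v + ?s i * g (v - w)"
        using s[of i] by (intro convex_onD[OF convex]) auto
      moreover have "(1 - ?s i) *\<^sub>R v + ?s i *\<^sub>R (v - w) = v - ?s i *\<^sub>R w"
        by (simp add: algebra_simps)
      ultimately have "?s i * (g v - g (v - w)) \<le> g v - g (v - ?s i *\<^sub>R w)"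
        by (simp add: algebra_simps)
      then have "?s i * ((g v - g (v - w)) * plateau \<delta> v) \<le> (g v - g (v - ?s i *\<^sub>R w)) * plateau \<delta> v"
        using mult_right_mono[OF _ plateau_nonneg] by (simp only: mult.assoc[symmetric])
      then show "(g v - g (v - w)) * plateau \<delta> v \<le> (g v - g (v - ?s i *\<^sub>R w)) * plateau \<delta> v / ?s i"
        using s(1)[of i] by (simp only: pos_le_divide_eq) (simp only: mult.commute)
    qed
    also have "\<dots> = ((\<integral>v. g v * plateau \<delta> v \<partial>lborel) - (\<integral>v. g (v - ?s i *\<^sub>R w) * plateau \<delta> v \<partial>lborel)) / ?s i"
      by (simp only: left_diff_distrib integral_divide_zero Bochner_Integration.integral_diff[OF int1 int2])
    also have "\<dots> = (\<integral>v. g v * ?q i v \<partial>lborel)"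
      unfolding shift
      by (simp only: times_divide_eq_right right_diff_distrib integral_divide_zero Bochner_Integration.integral_diff[OF int1 int3])
    finally show ?thesis .
  qed
  have "(\<lambda>i. \<integral>v. g v * ?q i v \<partial>lborel) \<longlonglongrightarrow>
    (\<integral>v. g v * (indicator A v * (sgn v \<bullet> w) / \<delta>) \<partial>lborel)"
  proof (rule integral_dominated_convergence)
    show "(\<lambda>v. g v * (indicator A v * (sgn v \<bullet> w) / \<delta>)) \<in> borel_measurable lborel"
      by measurable
    show "(\<lambda>v. g v * ?q i v) \<in> borel_measurable lborel" for i
      by simp
    show "integrable lborel (\<lambda>v :: 'a. C * indicator (cball 0 R) v)"
    proof (rule integrable_bounded_on_bounded)
      show "\<bar>C * indicator (cball 0 R) v\<bar> \<le> C * indicator (cball 0 R) v" for v :: 'a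
        using K \<delta> by (auto simp: C_def R_def indicator_def)
      have [measurable]: "cball (0 :: 'a) R \<in> sets borel" by simp
      show "(\<lambda>v :: 'a. C * indicator (cball 0 R) v) \<in> borel_measurable borel" by measurable
    qed
    show "AE v in lborel. (\<lambda>i. g v * ?q i v) \<longlonglongrightarrow>
        g v * (indicator A v * (sgn v \<bullet> w) / \<delta>)"
      using AE_lborel_norm_neq[of 1] AE_lborel_norm_neq[of "1 + \<delta>"]
      by eventually_elim (unfold A_def, intro tendsto_mult tendsto_const plateau_difference_quotient \<delta>)
    show "AE v in lborel. norm (g v * ?q i v) \<le> C * indicator (cball 0 R) v" for i
    proof (rule AE_I2)
      fix v :: 'a
      show "norm (g v * ?q i v) \<le> C * indicator (cball 0 R) v"
      proof (cases "norm v \<le> R")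
        case True
        have "\<bar>g v\<bar> \<le> \<bar>g 0\<bar> + K * norm v"
          using lipschitz_on_abs_diff_le[OF lip, of v 0] by simp
        then have "\<bar>g v\<bar> \<le> \<bar>g 0\<bar> + K * R"
          using mult_left_mono[OF True K] by linarith
        moreover have "\<bar>?q i v\<bar> \<le> norm w / \<delta>"
          using plateau_quotient_le[OF \<delta> s[of i], of v w] True by (simp only: R_def) (simp add: indicator_def)
        ultimately have "\<bar>g v\<bar> * \<bar>?q i v\<bar> \<le> C"
          unfolding C_def by (intro mult_mono) auto
        then show ?thesis using True by (simp only: real_norm_def abs_mult) (simp add: indicator_def)
      next
        case False
        then have "\<bar>?q i v\<bar> \<le> 0"
          using plateau_quotient_le[OF \<delta> s[of i], of v w] by (simp only: R_def) (simp add: indicator_def)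
        then show ?thesis
          using False by (simp only: abs_le_zero_iff mult_zero_right norm_zero) (simp add: indicator_def)
      qed
    qed
  qed
  then have "(\<integral>v. (g v - g (v - w)) * plateau \<delta> v \<partial>lborel) \<le>
    (\<integral>v. g v * (indicator A v * (sgn v \<bullet> w) / \<delta>) \<partial>lborel)"
    by (rule LIMSEQ_le_const) (intro exI allI impI step)
  also have "\<dots> = (\<integral>v. indicator A v * (g v * (sgn v \<bullet> w)) \<partial>lborel) / \<delta>"
    unfolding integral_divide_zero[symmetric] by (rule Bochner_Integration.integral_cong) auto
  finally show ?thesis unfolding A_def .
qed

text \<open>
  Jensen's inequality for a symmetric weight: average \<open>g v\<close> and \<open>g (- v)\<close>.
\<close>

lemma integral_symmetric_convex_ge:
  fixes g \<psi> :: "'a::euclidean_space \<Rightarrow> real"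
  assumes convex: "convex_on UNIV g" and [measurable]: "g \<in> borel_measurable borel" "\<psi> \<in> borel_measurable borel"
    and nonneg: "\<And>v. 0 \<le> \<psi> v" and even: "\<And>v. \<psi> (- v) = \<psi> v"
    and int: "integrable lborel (\<lambda>v. g v * \<psi> v)" "integrable lborel \<psi>"
  shows "g 0 * (\<integral>v. \<psi> v \<partial>lborel) \<le> (\<integral>v. g v * \<psi> v \<partial>lborel)"
proof -
  have reflect: "(\<integral>v. g v * \<psi> v \<partial>lborel) = (\<integral>v. g (- v) * \<psi> v \<partial>lborel)"
    by (subst lborel_integral_affine[of "-1" _ 0]) (simp_all add: even)
  have int': "integrable lborel (\<lambda>v. g (- v) * \<psi> v)"
  proof -
    have "lborel = distr lborel borel (uminus :: 'a \<Rightarrow> 'a)"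
      using lborel_affine[of "-1" "0 :: 'a"] by (simp add: density_1)
    with int(1) have "integrable (distr lborel borel uminus) (\<lambda>v. g v * \<psi> v)"
      by simp
    then show ?thesis
      by (subst (asm) integrable_distr_eq) (simp_all add: even)
  qed
  have "2 * (g 0 * (\<integral>v. \<psi> v \<partial>lborel)) = (\<integral>v. 2 * g 0 * \<psi> v \<partial>lborel)"
    by simp
  also have "\<dots> \<le> (\<integral>v. g v * \<psi> v + g (- v) * \<psi> v \<partial>lborel)"
  proof (rule integral_mono)
    fix v
    have "g ((1 - 1/2) *\<^sub>R v + (1/2) *\<^sub>R (- v)) \<le> (1 - 1/2) * g v + (1/2) * g (- v)"
      by (intro convex_onD[OF convex]) auto
    then have "2 * g 0 \<le> g v + g (- v)" by simp
    from mult_right_mono[OF this nonneg] show "2 * g 0 * \<psi> v \<le> g v * \<psi> v + g (- v) * \<psi> v"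
      by (simp add: distrib_right)
  qed (use int int' in auto)
  also have "\<dots> = 2 * (\<integral>v. g v * \<psi> v \<partial>lborel)"
    using int int' reflect by simp
  finally show ?thesis by simp
qed

lemma integral_plateau_bounds:
  assumes \<delta>: "\<delta> > 0"
  shows "unit_ball_volume TYPE('n) \<le> (\<integral>v. plateau \<delta> v \<partial>(lborel :: (real ^ 'n) measure))"
    and "(\<integral>v. plateau \<delta> v \<partial>(lborel :: (real ^ 'n) measure)) \<le> (1 + \<delta>) ^ CARD('n) * unit_ball_volume TYPE('n)"
proof -
  interpret prob_space "unif_sphere :: (real ^ 'n) measure" by (rule prob_space_unif_sphere)
  have vol: "(\<integral>v. indicator (ball 0 r) v \<partial>(lborel :: (real ^ 'n) measure)) = r ^ CARD('n) * unit_ball_volume TYPE('n)"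
    if "r > 0" for r
    using integral_ball_radial_projection[of "\<lambda>_ :: real ^ 'n. 1" r] that prob_space by simp
  have int_ball: "integrable lborel (indicator (ball 0 r) :: real ^ 'n \<Rightarrow> real)" for r
    by (rule integrable_bounded_on_bounded[of _ 1 r]) (auto simp: indicator_def)
  have int: "integrable lborel (plateau \<delta> :: real ^ 'n \<Rightarrow> real)"
    by (rule integrable_continuous_bounded_support[of _ "1 + \<delta>"])
      (auto simp: continuous_plateau plateau_outside \<delta>)
  have "(\<integral>v. indicator (ball 0 1) v \<partial>(lborel :: (real ^ 'n) measure)) \<le> (\<integral>v. plateau \<delta> v \<partial>(lborel :: (real ^ 'n) measure))"
    by (intro integral_mono int int_ball) (auto simp: indicator_def plateau_inside \<delta> plateau_nonneg)
  then show "unit_ball_volume TYPE('n) \<le> (\<integral>v. plateau \<delta> v \<partial>(lborel :: (real ^ 'n) measure))"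
    by (simp add: vol)
  have "(\<integral>v. plateau \<delta> v \<partial>(lborel :: (real ^ 'n) measure)) \<le> (\<integral>v. indicator (ball 0 (1 + \<delta>)) v \<partial>(lborel :: (real ^ 'n) measure))"
    by (intro integral_mono int int_ball) (auto simp: indicator_def plateau_outside \<delta> plateau_le_1)
  then show "(\<integral>v. plateau \<delta> v \<partial>(lborel :: (real ^ 'n) measure)) \<le> (1 + \<delta>) ^ CARD('n) * unit_ball_volume TYPE('n)"
    using \<delta> vol[of "1 + \<delta>"] by simp
qed

text \<open>
  On the shell \<open>v\<close> and \<open>sgn v\<close> are less than \<open>\<delta>\<close> apart, so replacing \<open>g v\<close> by \<open>g (sgn v)\<close> costs at
  most \<open>K * \<delta>\<close>; what remains depends on \<open>sgn v\<close> only.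
\<close>

lemma shell_integral_le:
  fixes g :: "real ^ 'n \<Rightarrow> real"
  assumes lip: "K-lipschitz_on UNIV g" and \<delta>: "\<delta> > 0"
  shows "(\<integral>v. indicator (ball 0 (1 + \<delta>) - ball 0 1) v * (g v * (sgn v \<bullet> w)) \<partial>lborel) \<le>
    ((1 + \<delta>) ^ CARD('n) - 1) * unit_ball_volume TYPE('n) *
      ((\<integral>u. g u * (u \<bullet> w) \<partial>unif_sphere) + K * \<delta> * norm w)"
proof -
  interpret prob_space "unif_sphere :: (real ^ 'n) measure" by (rule prob_space_unif_sphere)
  define A :: "(real ^ 'n) set" where "A = ball 0 (1 + \<delta>) - ball 0 1"
  have [measurable]: "A \<in> sets borel" by (simp add: A_def)
  have [measurable]: "g \<in> borel_measurable borel" by (rule lipschitz_on_borel_measurable[OF lip])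
  have K: "K \<ge> 0" using lip by (rule lipschitz_on_nonneg)
  have K\<delta>: "0 \<le> K * \<delta> * norm w" using K \<delta> by simp
  define G where "G = \<bar>g 0\<bar> + K * (1 + \<delta>)"
  have g_le: "\<bar>g v\<bar> \<le> G" if "norm v \<le> 1 + \<delta>" for v
    using lipschitz_on_abs_diff_le[OF lip, of v 0] mult_left_mono[OF that K] by (simp add: G_def)
  have inner_le: "\<bar>u \<bullet> w\<bar> \<le> norm w" if "norm u \<le> 1" for u
    using Cauchy_Schwarz_ineq2[of u w] mult_right_mono[OF that norm_ge_zero[of w]] by simp
  have sgn1: "norm (sgn v) \<le> 1" for v :: "real ^ 'n" by (simp add: norm_sgn)
  have \<phi>_bound: "\<bar>g u * (u \<bullet> w)\<bar> \<le> G * norm w" if "norm u \<le> 1" for u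
    unfolding abs_mult using g_le[of u] inner_le[OF that] that \<delta> by (intro mult_mono) auto
  have "(\<integral>v. indicator A v * (g v * (sgn v \<bullet> w)) \<partial>lborel) \<le>
    (\<integral>v. indicator A v * (g (sgn v) * (sgn v \<bullet> w) + K * \<delta> * norm w) \<partial>lborel)"
  proof (rule integral_mono)
    show "integrable lborel (\<lambda>v. indicator A v * (g v * (sgn v \<bullet> w)))"
    proof (rule integrable_bounded_on_bounded)
      fix v :: "real ^ 'n"
      show "\<bar>indicator A v * (g v * (sgn v \<bullet> w))\<bar> \<le> (G * norm w) * indicator (cball 0 (1 + \<delta>)) v"
        using g_le[of v] inner_le[OF sgn1[of v]] K \<delta>
        by (auto simp: indicator_def A_def abs_mult G_def intro!: mult_mono)
    qed measurable
    show "integrable lborel (\<lambda>v. indicator A v * (g (sgn v) * (sgn v \<bullet> w) + K * \<delta> * norm w))"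
    proof (rule integrable_bounded_on_bounded)
      fix v :: "real ^ 'n"
      have "\<bar>g (sgn v) * (sgn v \<bullet> w) + K * \<delta> * norm w\<bar> \<le> G * norm w + K * \<delta> * norm w"
        using \<phi>_bound[OF sgn1[of v]] K\<delta> by linarith
      moreover have "0 \<le> G * norm w + K * \<delta> * norm w"
        using K \<delta> by (simp add: G_def)
      ultimately show "\<bar>indicator A v * (g (sgn v) * (sgn v \<bullet> w) + K * \<delta> * norm w)\<bar> \<le>
          (G * norm w + K * \<delta> * norm w) * indicator (cball 0 (1 + \<delta>)) v"
        by (auto simp: indicator_def A_def)
    qed measurable
    fix v :: "real ^ 'n"
    show "indicator A v * (g v * (sgn v \<bullet> w)) \<le> indicator A v * (g (sgn v) * (sgn v \<bullet> w) + K * \<delta> * norm w)"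
    proof (cases "v \<in> A")
      case True
      then have v: "1 \<le> norm v" "norm v < 1 + \<delta>" by (auto simp: A_def)
      have "v - sgn v = (norm v - 1) *\<^sub>R sgn v"
      proof -
        have "norm v *\<^sub>R sgn v = v"
          by (cases "v = 0") (auto simp: sgn_div_norm)
        then show ?thesis by (simp add: scaleR_left_diff_distrib)
      qed
      then have "norm (v - sgn v) \<le> \<delta>"
        using v mult_mono[of "norm v - 1" \<delta> "norm (sgn v)" 1] sgn1[of v] by simp
      then have "\<bar>g v - g (sgn v)\<bar> \<le> K * \<delta>"
        using lipschitz_on_abs_diff_le[OF lip, of v "sgn v"] mult_left_mono[of "norm (v - sgn v)" \<delta> K] K by linarith
      then have "\<bar>(g v - g (sgn v)) * (sgn v \<bullet> w)\<bar> \<le> K * \<delta> * norm w"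
        unfolding abs_mult using inner_le[OF sgn1[of v]] K \<delta> by (intro mult_mono) auto
      then show ?thesis using True by (simp add: left_diff_distrib)
    qed simp
  qed
  also have "\<dots> = ((1 + \<delta>) ^ CARD('n) - 1) * unit_ball_volume TYPE('n) *
      (\<integral>u. g u * (u \<bullet> w) + K * \<delta> * norm w \<partial>unif_sphere)"
    unfolding A_def
  proof (rule integral_shell_radial_projection[OF _ \<delta>])
    show "\<bar>g u * (u \<bullet> w) + K * \<delta> * norm w\<bar> \<le> G * norm w + K * \<delta> * norm w" if "norm u \<le> 1" for u
      using \<phi>_bound[OF that] K\<delta> by linarith
  qed measurable
  also have "(\<integral>u. g u * (u \<bullet> w) + K * \<delta> * norm w \<partial>unif_sphere) = (\<integral>u. g u * (u \<bullet> w) \<partial>unif_sphere) + K * \<delta> * norm w"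
    using prob_space \<phi>_bound
    by (subst Bochner_Integration.integral_add) (auto intro!: integrable_unif_sphere[of _ "G * norm w"])
  finally show ?thesis unfolding A_def .
qed

text \<open>
  For smooth \<open>g\<close> the divergence theorem identifies the right-hand side with the mean over the unit
  ball of the directional derivative of \<open>g\<close> along \<open>w\<close>; by convexity this is at least the mean of
  \<open>g v - g (v - w)\<close>, where the mean of \<open>g v\<close> is at least \<open>g 0\<close> and \<open>g (v - w)\<close> is at most
  \<open>g (- w) + K\<close>. The proof replaces the ball by the cut-off of width \<open>\<delta>\<close>, which gives the same
  estimate up to errors that vanish with \<open>\<delta>\<close>.
\<close>

lemma sphere_gradient_inequality:
  fixes g :: "real ^ 'n \<Rightarrow> real"
  assumes convex: "convex_on UNIV g" and lip: "K-lipschitz_on UNIV g"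
  shows "g 0 - g (- w) - K \<le> real CARD('n) * (\<integral>u. g u * (u \<bullet> w) \<partial>unif_sphere)"
proof -
  let ?n = "CARD('n)" and ?B = "unit_ball_volume TYPE('n)"
  define E where "E = (\<integral>u. g u * (u \<bullet> w) \<partial>unif_sphere)"
  define I where "I \<delta> = (\<integral>v. plateau \<delta> v \<partial>(lborel :: (real ^ 'n) measure))" for \<delta>
  define s where "s i = inverse (real (Suc i))" for i
  have K: "K \<ge> 0" using lip by (rule lipschitz_on_nonneg)
  have B: "?B > 0"
    by (rule unit_ball_volume_pos)
  have bound: "(g 0 - g (- w) - K * (1 + \<delta>)) * I \<delta> \<le> (((1 + \<delta>) ^ ?n - 1) / \<delta>) * ?B * (E + K * \<delta> * norm w)"
    if \<delta>: "\<delta> > 0" for \<delta>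
  proof -
    have [measurable]: "g \<in> borel_measurable borel" by (rule lipschitz_on_borel_measurable[OF lip])
    have [measurable]: "plateau \<delta> \<in> borel_measurable (borel :: (real ^ 'n) measure)"
      by (rule borel_measurable_continuous_onI) (rule continuous_plateau[OF \<delta>])
    note [continuous_intros] = continuous_on_compose2[OF lipschitz_on_continuous_on[OF lip]]
      continuous_on_compose2[OF continuous_plateau[OF \<delta>, of UNIV]]
    have int1: "integrable lborel (plateau \<delta> :: real ^ 'n \<Rightarrow> real)"
      by (rule integrable_continuous_bounded_support[of _ "1 + \<delta>"])
        (auto simp: continuous_plateau plateau_outside \<delta>)
    have int2: "integrable lborel (\<lambda>v. g (v - y) * plateau \<delta> v)" for y
      by (rule integrable_continuous_bounded_support[of _ "1 + \<delta>"])
        (auto intro!: continuous_intros simp: plateau_outside \<delta>)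
    have "g 0 * I \<delta> \<le> (\<integral>v. g v * plateau \<delta> v \<partial>lborel)"
      unfolding I_def using int1 int2[of 0]
      by (intro integral_symmetric_convex_ge[OF convex]) (auto simp: plateau_nonneg)
    moreover have "(\<integral>v. g (v - w) * plateau \<delta> v \<partial>lborel) \<le> (\<integral>v. (g (- w) + K * (1 + \<delta>)) * plateau \<delta> v \<partial>(lborel :: (real ^ 'n) measure))"
    proof (rule integral_mono)
      fix v :: "real ^ 'n"
      show "g (v - w) * plateau \<delta> v \<le> (g (- w) + K * (1 + \<delta>)) * plateau \<delta> v"
      proof (cases "norm v \<le> 1 + \<delta>")
        case True
        have "g (v - w) \<le> g (- w) + K * (1 + \<delta>)"
          using lipschitz_on_abs_diff_le[OF lip, of "v - w" "- w"] mult_left_mono[OF True K] by simp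
        then show ?thesis by (rule mult_right_mono) (rule plateau_nonneg)
      qed (simp add: plateau_outside \<delta>)
    qed (use int1 int2 in auto)
    moreover have "(\<integral>v. (g (- w) + K * (1 + \<delta>)) * plateau \<delta> v \<partial>(lborel :: (real ^ 'n) measure)) =
        (g (- w) + K * (1 + \<delta>)) * I \<delta>"
      unfolding I_def by (rule integral_mult_right_zero)
    moreover have "(g 0 - g (- w) - K * (1 + \<delta>)) * I \<delta> = g 0 * I \<delta> - (g (- w) + K * (1 + \<delta>)) * I \<delta>"
      by (simp add: algebra_simps)
    ultimately have "(g 0 - g (- w) - K * (1 + \<delta>)) * I \<delta> \<le>
      (\<integral>v. g v * plateau \<delta> v \<partial>lborel) - (\<integral>v. g (v - w) * plateau \<delta> v \<partial>lborel)"
      by linarith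
    also have "\<dots> = (\<integral>v. (g v - g (v - w)) * plateau \<delta> v \<partial>lborel)"
      using int2[of 0] int2[of w] by (simp add: left_diff_distrib)
    also have "\<dots> \<le> (\<integral>v. indicator (ball 0 (1 + \<delta>) - ball 0 1) v * (g v * (sgn v \<bullet> w)) \<partial>lborel) / \<delta>"
      by (rule convex_plateau_shell_inequality[OF convex lip \<delta>])
    also have "\<dots> \<le> ((1 + \<delta>) ^ ?n - 1) * ?B * (E + K * \<delta> * norm w) / \<delta>"
      unfolding E_def using \<delta> by (intro divide_right_mono shell_integral_le lip) auto
    finally show ?thesis by simp
  qed
  have s0: "s \<longlonglongrightarrow> 0" and s_pos: "s i > 0" for i
    unfolding s_def by (rule LIMSEQ_inverse_real_of_nat) auto
  have pow: "(\<lambda>i. (1 + s i) ^ ?n) \<longlonglongrightarrow> 1"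
    using tendsto_power[OF tendsto_add[OF tendsto_const s0], of 1 ?n] by simp
  have "(\<lambda>i. (1 + s i) ^ ?n * ?B) \<longlonglongrightarrow> ?B"
    using tendsto_mult[OF pow tendsto_const[of ?B]] by simp
  from tendsto_sandwich[OF _ _ tendsto_const this] have I: "(\<lambda>i. I (s i)) \<longlonglongrightarrow> ?B"
    using integral_plateau_bounds[OF s_pos, where 'n = 'n] by (auto simp: I_def)
  \<comment> \<open>the factor \<open>n\<close> is the growth rate of the volume of the ball at radius \<open>1\<close>\<close>
  have "((\<lambda>x :: real. x ^ ?n) has_real_derivative real ?n) (at 1)"
    by (auto intro!: derivative_eq_intros)
  then have "(\<lambda>h :: real. ((1 + h) ^ ?n - 1) / h) \<midarrow>0\<rightarrow> real ?n"
    by (simp add: DERIV_def)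
  moreover have "filterlim s (at 0) sequentially"
    using s0 s_pos by (auto simp: filterlim_at less_imp_neq[symmetric])
  ultimately have quot: "(\<lambda>i. ((1 + s i) ^ ?n - 1) / s i) \<longlonglongrightarrow> real ?n"
    by (rule filterlim_compose)
  have "(\<lambda>i. (g 0 - g (- w) - K * (1 + s i)) * I (s i)) \<longlonglongrightarrow> (g 0 - g (- w) - K * (1 + 0)) * ?B"
    by (intro tendsto_intros s0 I)
  moreover have "(\<lambda>i. (((1 + s i) ^ ?n - 1) / s i) * ?B * (E + K * s i * norm w)) \<longlonglongrightarrow>
    real ?n * ?B * (E + K * 0 * norm w)"
    by (intro tendsto_intros s0 quot)
  ultimately have "(g 0 - g (- w) - K * (1 + 0)) * ?B \<le> real ?n * ?B * (E + K * 0 * norm w)"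
    by (rule LIMSEQ_le) (use bound[OF s_pos] in auto)
  then have "(g 0 - g (- w) - K) * ?B \<le> (real ?n * E) * ?B"
    by (simp add: algebra_simps)
  then show ?thesis using B by (simp add: E_def)
qed

section \<open>Variance of Lipschitz functions on the sphere\<close>

lemma uniform_measure_distr:
  assumes f [measurable]: "f \<in> M \<rightarrow>\<^sub>M N" and [measurable]: "A \<in> sets N"
  shows "uniform_measure (distr M N f) A = distr (uniform_measure M (f -` A \<inter> space M)) N f"
proof (rule measure_eqI)
  fix B assume "B \<in> sets (uniform_measure (distr M N f) A)"
  then have [measurable]: "B \<in> sets N" by simp
  have "f -` A \<inter> space M \<inter> (f -` B \<inter> space M) = f -` (A \<inter> B) \<inter> space M" by auto
  then show "emeasure (uniform_measure (distr M N f) A) B = emeasure (distr (uniform_measure M (f -` A \<inter> space M)) N f) B"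
    by (simp add: emeasure_distr)
qed simp

text \<open>
  An enumeration of the index type identifies coordinate functions on \<open>{..<CARD('n)}\<close> with vectors,
  which is what carries the bound behind \<open>sphere_fourth_moment_const\<close> over to \<open>unif_sphere\<close>.
\<close>

locale vector_coordinates =
  fixes index :: "'n::finite \<Rightarrow> nat"
  assumes bij_index: "bij_betw index UNIV {..<CARD('n)}"
begin

definition vec :: "(nat \<Rightarrow> real) \<Rightarrow> real ^ 'n" where
  "vec x = (\<chi> j. x (index j))"

lemma vec_nth [simp]: "vec x $ j = x (index j)"
  by (simp add: vec_def)

lemma index_less [simp]: "index j < CARD('n)"
  using bij_index by (auto simp: bij_betw_def)

lemma norm_vec: "norm (vec x) = L2_set x {..<CARD('n)}"
  unfolding norm_vec_def L2_set_def
  by (simp add: sum.reindex_bij_betw[OF bij_index, of "\<lambda>i. (x i)\<^sup>2"])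

lemma measurable_vec [measurable]: "vec \<in> borel_measurable (\<Pi>\<^sub>M i\<in>{..<CARD('n)}. borel)"
  by (subst borel_measurable_euclidean_space) (auto simp: Basis_vec_def inner_axis intro!: measurable_component_singleton)

lemma measurable_vec_lborel [measurable]: "vec \<in> borel_measurable (\<Pi>\<^sub>M i\<in>{..<CARD('n)}. lborel)"
  by (subst borel_measurable_euclidean_space) (auto simp: Basis_vec_def inner_axis measurable_lborel1[symmetric] simp del: measurable_lborel1 intro!: measurable_component_singleton)

text \<open>
  The Lebesgue measure is determined by its values on boxes, and the preimage of a box is a product of
  intervals.
\<close>

lemma distr_vec_lborel: "distr (\<Pi>\<^sub>M i\<in>{..<CARD('n)}. lborel) borel vec = lborel"
proof (rule lborel_eqI[symmetric])
  interpret product_sigma_finite "\<lambda>_ :: nat. lborel :: real measure" ..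
  fix l u :: "real ^ 'n"
  assume le_Basis: "\<And>b. b \<in> Basis \<Longrightarrow> l \<bullet> b \<le> u \<bullet> b"
  have le: "l $ j \<le> u $ j" for j
    using le_Basis[of "axis j 1"] by (auto simp: Basis_vec_def inner_axis)
  let ?j = "inv index"
  have j: "index (?j i) = i" if "i < CARD('n)" for i
    using bij_index that by (metis bij_betw_def f_inv_into_f lessThan_iff)
  have inv: "?j (index k) = k" for k
    using bij_index by (simp add: bij_betw_def)
  have "vec -` box l u \<inter> space (\<Pi>\<^sub>M i\<in>{..<CARD('n)}. lborel) =
      (\<Pi>\<^sub>E i\<in>{..<CARD('n)}. {l $ ?j i <..< u $ ?j i})"
  proof -
    have "(\<forall>k. l $ k < x (index k) \<and> x (index k) < u $ k) \<longleftrightarrow>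
        (\<forall>i<CARD('n). l $ ?j i < x i \<and> x i < u $ ?j i)" for x
    proof (intro iffI allI impI)
      fix i assume *: "\<forall>k. l $ k < x (index k) \<and> x (index k) < u $ k" and "i < CARD('n)"
      then show "l $ ?j i < x i \<and> x i < u $ ?j i" using *[rule_format, of "?j i"] by (simp add: j)
    next
      fix k assume *: "\<forall>i<CARD('n). l $ ?j i < x i \<and> x i < u $ ?j i"
      then show "l $ k < x (index k) \<and> x (index k) < u $ k" using *[rule_format, of "index k"] by (simp add: inv)
    qed
    then show ?thesis
      by (auto simp: mem_box_cart space_PiM PiE_iff)
  qed
  then have "emeasure (distr (\<Pi>\<^sub>M i\<in>{..<CARD('n)}. lborel) borel vec) (box l u) =
      (\<Prod>i<CARD('n). ennreal (u $ ?j i - l $ ?j i))"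
    by (simp add: emeasure_distr emeasure_PiM le)
  also have "\<dots> = (\<Prod>k\<in>UNIV. ennreal (u $ k - l $ k))"
    using prod.reindex_bij_betw[OF bij_index, of "\<lambda>i. ennreal (u $ ?j i - l $ ?j i)"] by (simp add: inv)
  also have "\<dots> = ennreal (\<Prod>k\<in>UNIV. (u - l) $ k)"
    using le by (simp add: prod_ennreal)
  also have "(\<Prod>k\<in>UNIV. (u - l) $ k) = (\<Prod>b\<in>Basis. (u - l) \<bullet> b)"
    by (subst prod.reindex_bij_betw[symmetric, of "\<lambda>k. axis k 1" UNIV])
      (auto simp: Basis_vec_def inner_axis bij_betw_def inj_on_def axis_eq_axis)
  finally show "emeasure (distr (\<Pi>\<^sub>M i\<in>{..<CARD('n)}. lborel) borel vec) (box l u) = ennreal (\<Prod>b\<in>Basis. (u - l) \<bullet> b)" .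
qed simp

text \<open>
  Both sides project the normalised Lebesgue measure of the unit ball radially, and \<open>vec\<close> commutes
  with this projection because it preserves the norm.
\<close>

lemma unif_sphere_eq_distr_vec: "unif_sphere = distr (coord_unif_sphere CARD('n)) borel vec"
proof -
  let ?n = "CARD('n)"
  let ?P = "\<Pi>\<^sub>M i\<in>{..<?n}. (lborel :: real measure)"
  let ?S = "{x \<in> {..<?n} \<rightarrow>\<^sub>E UNIV. L2_set x {..<?n} < 1}"
  let ?proj = "\<lambda>x. \<lambda>i\<in>{..<?n}. x i / L2_set x {..<?n}"
  have S: "?S = vec -` ball 0 1 \<inter> space ?P"
    by (simp add: space_PiM norm_vec vimage_def Int_def conj_commute)
  have [measurable]: "?proj \<in> ?P \<rightarrow>\<^sub>M (\<Pi>\<^sub>M i\<in>{..<?n}. borel)"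
    unfolding L2_set_def by measurable
  have sgn: "sgn (vec x) = vec (?proj x)" for x
    by (simp add: vec_eq_iff sgn_div_norm norm_vec divide_inverse mult.commute)
  have "unif_sphere = distr (distr (uniform_measure ?P ?S) borel vec) borel sgn"
    unfolding unif_sphere_def S
    by (subst distr_vec_lborel[symmetric]) (simp add: uniform_measure_distr)
  also have "\<dots> = distr (uniform_measure ?P ?S) borel (vec \<circ> ?proj)"
    by (subst distr_distr) (auto simp: sgn comp_def)
  also have "\<dots> = distr (coord_unif_sphere ?n) borel vec"
    unfolding coord_unif_sphere_def by (subst distr_distr) auto
  finally show ?thesis .
qed

end

lemma (in prob_space) integral_square_le_sqrt_fourth_moment:
  fixes Z :: "'a \<Rightarrow> real"
  assumes "integrable M (\<lambda>x. (Z x)\<^sup>2)" "integrable M (\<lambda>x. Z x ^ 4)"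
  shows "(\<integral>x. (Z x)\<^sup>2 \<partial>M) \<le> sqrt (\<integral>x. Z x ^ 4 \<partial>M)"
proof -
  have "0 \<le> variance (\<lambda>x. (Z x)\<^sup>2)"
    by (rule variance_positive)
  also have "\<dots> = (\<integral>x. Z x ^ 4 \<partial>M) - (\<integral>x. (Z x)\<^sup>2 \<partial>M)\<^sup>2"
    using assms by (subst variance_eq) (simp_all add: power_mult[symmetric])
  finally show ?thesis
    by (intro real_le_rsqrt) simp
qed

text \<open>
  The second central moment is at most the square root of the fourth one.
\<close>

lemma unif_sphere_variance_le:
  fixes g :: "real ^ 'n \<Rightarrow> real"
  assumes c: "sphere_fourth_moment_const c" and M: "M > 0" and lip: "M-lipschitz_on UNIV g"
  shows "(\<integral>u. (g u - (\<integral>v. g v \<partial>unif_sphere))\<^sup>2 \<partial>unif_sphere) \<le> c * M\<^sup>2 / real CARD('n)"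
proof -
  interpret prob_space "unif_sphere :: (real ^ 'n) measure" by (rule prob_space_unif_sphere)
  obtain index :: "'n \<Rightarrow> nat" where "bij_betw index UNIV {0..<CARD('n)}"
    using ex_bij_betw_finite_nat[of "UNIV :: 'n set"] by auto
  then interpret vector_coordinates index
    by unfold_locales (simp add: atLeast0LessThan)
  let ?n = "CARD('n)"
  have [measurable]: "g \<in> borel_measurable borel" by (rule lipschitz_on_borel_measurable[OF lip])
  have [measurable]: "vec \<in> borel_measurable (coord_unif_sphere ?n)"
    unfolding coord_unif_sphere_def by simp
  define m where "m = (\<integral>v. g v \<partial>unif_sphere)"
  have transfer: "(\<integral>u. \<phi> u \<partial>unif_sphere) = (\<integral>x. \<phi> (vec x) \<partial>coord_unif_sphere ?n)"
    if [measurable]: "\<phi> \<in> borel_measurable borel" for \<phi> :: "real ^ 'n \<Rightarrow> real"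
    unfolding unif_sphere_eq_distr_vec by (rule integral_distr) auto
  have coord_lip: "coord_lipschitz ?n M (g \<circ> vec)"
    unfolding coord_lipschitz_def
  proof (intro ballI)
    fix x y :: "nat \<Rightarrow> real"
    have "vec x - vec y = vec (\<lambda>i. x i - y i)" by (simp add: vec_eq_iff)
    then show "\<bar>(g \<circ> vec) x - (g \<circ> vec) y\<bar> \<le> M * L2_set (\<lambda>i. x i - y i) {..<?n}"
      using lipschitz_on_abs_diff_le[OF lip, of "vec x" "vec y"] by (simp add: norm_vec)
  qed
  have bound: "sqrt (\<integral>u. ((g \<circ> vec) u - (\<integral>v. (g \<circ> vec) v \<partial>coord_unif_sphere ?n)) ^ 4 \<partial>coord_unif_sphere ?n) \<le> c * M\<^sup>2 / real ?n"
    by (rule c[unfolded sphere_fourth_moment_const_def, rule_format, OF _ M coord_lip]) (simp add: Suc_leI)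
  have "m = (\<integral>v. g (vec v) \<partial>coord_unif_sphere ?n)"
    unfolding m_def by (rule transfer) simp
  moreover have "(\<integral>u. (g u - m) ^ 4 \<partial>unif_sphere) = (\<integral>u. (g (vec u) - m) ^ 4 \<partial>coord_unif_sphere ?n)"
    by (rule transfer) simp
  ultimately have fourth: "sqrt (\<integral>u. (g u - m) ^ 4 \<partial>unif_sphere) \<le> c * M\<^sup>2 / real ?n"
    using bound by simp
  have g_bound: "\<bar>g u - m\<bar> \<le> \<bar>g 0 - m\<bar> + M" if "norm u = 1" for u
    using lipschitz_on_abs_diff_le[OF lip, of u 0] that by simp
  have int: "integrable unif_sphere (\<lambda>u. (g u - m) ^ k)" for k
    using g_bound by (intro integrable_unif_sphere[of _ "(\<bar>g 0 - m\<bar> + M) ^ k"])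
      (auto simp: power_abs intro!: power_mono)
  show ?thesis
    using integral_square_le_sqrt_fourth_moment[OF int int] fourth unfolding m_def by linarith
qed

section \<open>Independence of random variables of different types\<close>

text \<open>
  Independence of two random variables whose values may have different types, unlike \<open>indep_var\<close>.
\<close>

definition (in prob_space) indep_pair ::
  "'b measure \<Rightarrow> ('a \<Rightarrow> 'b) \<Rightarrow> 'c measure \<Rightarrow> ('a \<Rightarrow> 'c) \<Rightarrow> bool" where
  "indep_pair N X K Y \<longleftrightarrow> random_variable N X \<and> random_variable K Y \<and>
     (\<forall>A\<in>sets N. \<forall>B\<in>sets K. prob ((X -` A \<inter> space M) \<inter> (Y -` B \<inter> space M)) =
        prob (X -` A \<inter> space M) * prob (Y -` B \<inter> space M))"

context prob_space
begin

lemma indep_pair_measurable: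
  assumes "indep_pair N X K Y"
  shows "random_variable N X" "random_variable K Y"
  using assms by (auto simp: indep_pair_def)

lemma indep_pairD:
  "indep_pair N X K Y \<Longrightarrow> A \<in> sets N \<Longrightarrow> B \<in> sets K \<Longrightarrow>
    prob ((X -` A \<inter> space M) \<inter> (Y -` B \<inter> space M)) =
      prob (X -` A \<inter> space M) * prob (Y -` B \<inter> space M)"
  by (auto simp: indep_pair_def)

lemma indep_pair_if_indep_vimage_algebras:
  assumes XY: "random_variable N X" "random_variable K Y"
    and indep: "indep_set (sets (vimage_algebra (space M) X N)) (sets (vimage_algebra (space M) Y K))"
  shows "indep_pair N X K Y"
  unfolding indep_pair_def using XY by (auto intro!: indep_setD[OF indep] in_vimage_algebra)

lemma indep_pair_if_indep_var:
  assumes "indep_var N X K Y"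
  shows "indep_pair N X K Y"
proof -
  have "random_variable N X" "random_variable K Y"
    using assms by (auto dest: indep_var_rv1 indep_var_rv2)
  moreover from assms have "indep_set (sets (vimage_algebra (space M) X N)) (sets (vimage_algebra (space M) Y K))"
    unfolding indep_var_eq sets_vimage_algebra by simp
  ultimately show ?thesis by (rule indep_pair_if_indep_vimage_algebras)
qed

lemma indep_pair_compose:
  assumes indep: "indep_pair N X K Y" and f: "f \<in> N \<rightarrow>\<^sub>M N'" and g: "g \<in> K \<rightarrow>\<^sub>M K'"
  shows "indep_pair N' (\<lambda>\<omega>. f (X \<omega>)) K' (\<lambda>\<omega>. g (Y \<omega>))"
proof -
  note [measurable] = f g indep_pair_measurable[OF indep]
  have X: "(\<lambda>\<omega>. f (X \<omega>)) -` A \<inter> space M = X -` (f -` A \<inter> space N) \<inter> space M" for A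
    using measurable_space[OF indep_pair_measurable(1)[OF indep]] by auto
  have Y: "(\<lambda>\<omega>. g (Y \<omega>)) -` B \<inter> space M = Y -` (g -` B \<inter> space K) \<inter> space M" for B
    using measurable_space[OF indep_pair_measurable(2)[OF indep]] by auto
  show ?thesis
    unfolding indep_pair_def X Y
    by (intro conjI ballI indep_pairD[OF indep] measurable_sets[OF f] measurable_sets[OF g]) measurable
qed

lemma distr_indep_pair:
  assumes indep: "indep_pair N X K Y"
  shows "distr M (N \<Otimes>\<^sub>M K) (\<lambda>\<omega>. (X \<omega>, Y \<omega>)) = distr M N X \<Otimes>\<^sub>M distr M K Y"
proof -
  note [measurable] = indep_pair_measurable[OF indep]
  interpret X: prob_space "distr M N X" by (rule prob_space_distr) simp
  interpret Y: prob_space "distr M K Y" by (rule prob_space_distr) simp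
  show ?thesis
  proof (rule pair_measure_eqI[symmetric])
    show "sets (distr M N X \<Otimes>\<^sub>M distr M K Y) = sets (distr M (N \<Otimes>\<^sub>M K) (\<lambda>\<omega>. (X \<omega>, Y \<omega>)))"
      by simp
    fix A B assume "A \<in> sets (distr M N X)" "B \<in> sets (distr M K Y)"
    then have [measurable]: "A \<in> sets N" "B \<in> sets K" by auto
    have "(\<lambda>\<omega>. (X \<omega>, Y \<omega>)) -` (A \<times> B) \<inter> space M = (X -` A \<inter> space M) \<inter> (Y -` B \<inter> space M)"
      by auto
    then show "emeasure (distr M N X) A * emeasure (distr M K Y) B =
        emeasure (distr M (N \<Otimes>\<^sub>M K) (\<lambda>\<omega>. (X \<omega>, Y \<omega>))) (A \<times> B)"
      by (simp add: emeasure_distr emeasure_eq_measure indep_pairD[OF indep] ennreal_mult)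
  qed unfold_locales
qed

end

text \<open>
  Two independent families that are independent of each other combine to an independent family of
  pairs. Rectangles form an intersection-stable generator of the product \<open>\<sigma>\<close>-algebra, and on rectangles
  both sides factor into the probabilities for the single variables.
\<close>

lemma (in prob_space)
  assumes I: "finite I" "I \<noteq> {}"
    and U: "indep_vars N U I" and Z: "indep_vars K Z I"
    and joint: "indep_pair (\<Pi>\<^sub>M t\<in>I. N t) (\<lambda>\<omega>. \<lambda>t\<in>I. U t \<omega>) (\<Pi>\<^sub>M t\<in>I. K t) (\<lambda>\<omega>. \<lambda>t\<in>I. Z t \<omega>)"
  shows indep_vars_Pair: "indep_vars (\<lambda>t. N t \<Otimes>\<^sub>M K t) (\<lambda>t \<omega>. (U t \<omega>, Z t \<omega>)) I"
    and distr_Pair_indep_families: "t \<in> I \<Longrightarrow>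
      distr M (N t \<Otimes>\<^sub>M K t) (\<lambda>\<omega>. (U t \<omega>, Z t \<omega>)) = distr M (N t) (U t) \<Otimes>\<^sub>M distr M (K t) (Z t)"
proof -
  have Um [measurable]: "random_variable (N t) (U t)" and Zm [measurable]: "random_variable (K t) (Z t)" if "t \<in> I" for t
    using U Z that by (auto simp: indep_vars_def)
  have single: "indep_pair (N t) (U t) (K t) (Z t)" if "t \<in> I" for t
    using indep_pair_compose[OF joint measurable_component_singleton[OF that] measurable_component_singleton[OF that]] that
    by simp
  show "distr M (N t \<Otimes>\<^sub>M K t) (\<lambda>\<omega>. (U t \<omega>, Z t \<omega>)) = distr M (N t) (U t) \<Otimes>\<^sub>M distr M (K t) (Z t)" if "t \<in> I"
    by (rule distr_indep_pair[OF single[OF that]])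
  define E where "E t = {a \<times> b | a b. a \<in> sets (N t) \<and> b \<in> sets (K t)}" for t
  have "indep_vars (\<lambda>t. N t \<Otimes>\<^sub>M K t) (\<lambda>t \<omega>. (U t \<omega>, Z t \<omega>)) I \<longleftrightarrow>
    (\<forall>A\<in>(\<Pi> i\<in>I. E i). prob (\<Inter>j\<in>I. (\<lambda>\<omega>. (U j \<omega>, Z j \<omega>)) -` A j \<inter> space M) =
      (\<Prod>j\<in>I. prob ((\<lambda>\<omega>. (U j \<omega>, Z j \<omega>)) -` A j \<inter> space M)))"
  proof (rule indep_vars_finite[OF I(2,1)])
    fix i assume "i \<in> I"
    show "sets (N i \<Otimes>\<^sub>M K i) = sigma_sets (space (N i \<Otimes>\<^sub>M K i)) (E i)"
      unfolding E_def by (simp add: sets_pair_measure space_pair_measure)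
    show "random_variable (N i \<Otimes>\<^sub>M K i) (\<lambda>\<omega>. (U i \<omega>, Z i \<omega>))"
      using \<open>i \<in> I\<close> by measurable
    show "Int_stable (E i)"
      unfolding E_def by (rule Int_stable_pair_measure_generator)
    show "space (N i \<Otimes>\<^sub>M K i) \<in> E i"
      unfolding E_def by (auto simp: space_pair_measure)
    show "E i \<subseteq> Pow (space (N i \<Otimes>\<^sub>M K i))"
      unfolding E_def space_pair_measure by (rule pair_measure_closed)
  qed
  also have "\<dots>"
  proof
    fix C assume "C \<in> (\<Pi> i\<in>I. E i)"
    then have "\<forall>i\<in>I. \<exists>a b. C i = a \<times> b \<and> a \<in> sets (N i) \<and> b \<in> sets (K i)"
      by (auto simp: E_def Pi_iff)
    then obtain a b where C: "\<And>i. i \<in> I \<Longrightarrow> C i = a i \<times> b i"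
      and a: "\<And>i. i \<in> I \<Longrightarrow> a i \<in> sets (N i)" and b: "\<And>i. i \<in> I \<Longrightarrow> b i \<in> sets (K i)"
      by metis
    let ?RU = "\<lambda>\<omega>. \<lambda>t\<in>I. U t \<omega>" and ?RZ = "\<lambda>\<omega>. \<lambda>t\<in>I. Z t \<omega>"
    have "(\<Inter>j\<in>I. (\<lambda>\<omega>. (U j \<omega>, Z j \<omega>)) -` C j \<inter> space M) =
        (?RU -` Pi\<^sub>E I a \<inter> space M) \<inter> (?RZ -` Pi\<^sub>E I b \<inter> space M)"
      using I by (auto simp: C PiE_iff)
    also have "prob \<dots> = prob (?RU -` Pi\<^sub>E I a \<inter> space M) * prob (?RZ -` Pi\<^sub>E I b \<inter> space M)"
      using I a b by (intro indep_pairD[OF joint] sets_PiM_I_finite) auto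
    also have "?RU -` Pi\<^sub>E I a \<inter> space M = (\<Inter>t\<in>I. U t -` a t \<inter> space M)"
      using I by (auto simp: PiE_iff)
    also have "prob \<dots> = (\<Prod>t\<in>I. prob (U t -` a t \<inter> space M))"
      by (rule indep_varsD_finite[OF U I(2,1) a])
    also have "?RZ -` Pi\<^sub>E I b \<inter> space M = (\<Inter>t\<in>I. Z t -` b t \<inter> space M)"
      using I by (auto simp: PiE_iff)
    also have "prob \<dots> = (\<Prod>t\<in>I. prob (Z t -` b t \<inter> space M))"
      by (rule indep_varsD_finite[OF Z I(2,1) b])
    also have "(\<Prod>t\<in>I. prob (U t -` a t \<inter> space M)) * (\<Prod>t\<in>I. prob (Z t -` b t \<inter> space M)) =
        (\<Prod>t\<in>I. prob ((\<lambda>\<omega>. (U t \<omega>, Z t \<omega>)) -` C t \<inter> space M))"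
      unfolding prod.distrib[symmetric]
    proof (rule prod.cong[OF refl])
      fix t assume t: "t \<in> I"
      have "(\<lambda>\<omega>. (U t \<omega>, Z t \<omega>)) -` C t \<inter> space M = (U t -` a t \<inter> space M) \<inter> (Z t -` b t \<inter> space M)"
        by (auto simp: C[OF t])
      then show "prob (U t -` a t \<inter> space M) * prob (Z t -` b t \<inter> space M) =
          prob ((\<lambda>\<omega>. (U t \<omega>, Z t \<omega>)) -` C t \<inter> space M)"
        by (simp add: indep_pairD[OF single[OF t] a[OF t] b[OF t]])
    qed
    finally show "prob (\<Inter>j\<in>I. (\<lambda>\<omega>. (U j \<omega>, Z j \<omega>)) -` C j \<inter> space M) =
        (\<Prod>j\<in>I. prob ((\<lambda>\<omega>. (U j \<omega>, Z j \<omega>)) -` C j \<inter> space M))" .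
  qed
  finally show "indep_vars (\<lambda>t. N t \<Otimes>\<^sub>M K t) (\<lambda>t \<omega>. (U t \<omega>, Z t \<omega>)) I" .
qed

text \<open>
  A bound on the conditional expectation given \<open>p\<close>: freezing the value of \<open>p\<close> and integrating over
  \<open>w\<close> first (Tonelli) turns a bound that is uniform in the frozen value into integrability and a bound
  on the expectation.
\<close>

lemma (in prob_space) indep_pair_integral_le:
  fixes \<Phi> :: "'b \<times> 'c \<Rightarrow> real"
  assumes indep: "indep_pair N p K w" and \<Phi> [measurable]: "\<Phi> \<in> borel_measurable (N \<Otimes>\<^sub>M K)"
    and nonneg: "\<And>x y. 0 \<le> \<Phi> (x, y)"
    and int: "\<And>x. x \<in> space N \<Longrightarrow> integrable (distr M K w) (\<lambda>y. \<Phi> (x, y))"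
    and le: "\<And>x. x \<in> space N \<Longrightarrow> (\<integral>y. \<Phi> (x, y) \<partial>distr M K w) \<le> V"
  shows "integrable M (\<lambda>\<omega>. \<Phi> (p \<omega>, w \<omega>))" and "(\<integral>\<omega>. \<Phi> (p \<omega>, w \<omega>) \<partial>M) \<le> V"
proof -
  have rv [measurable]: "random_variable N p" "random_variable K w"
    by (fact indep_pair_measurable[OF indep])+
  interpret P: prob_space "distr M N p" by (rule prob_space_distr) simp
  interpret Q: prob_space "distr M K w" by (rule prob_space_distr) simp
  interpret PQ: pair_sigma_finite "distr M N p" "distr M K w" ..
  obtain x where "x \<in> space N" using P.not_empty by auto
  then have V: "0 \<le> V"
    using le[of x] Bochner_Integration.integral_nonneg[of "distr M K w" "\<lambda>y. \<Phi> (x, y)"] nonneg by fastforce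
  have "(\<integral>\<^sup>+\<omega>. ennreal (\<Phi> (p \<omega>, w \<omega>)) \<partial>M) = (\<integral>\<^sup>+z. ennreal (\<Phi> z) \<partial>distr M (N \<Otimes>\<^sub>M K) (\<lambda>\<omega>. (p \<omega>, w \<omega>)))"
    by (simp add: nn_integral_distr)
  also have "\<dots> = (\<integral>\<^sup>+z. ennreal (\<Phi> z) \<partial>(distr M N p \<Otimes>\<^sub>M distr M K w))"
    by (simp only: distr_indep_pair[OF indep])
  also have "\<dots> = (\<integral>\<^sup>+x. \<integral>\<^sup>+y. ennreal (\<Phi> (x, y)) \<partial>distr M K w \<partial>distr M N p)"
    by (rule Q.nn_integral_fst[symmetric]) measurable
  also have "\<dots> \<le> (\<integral>\<^sup>+x. ennreal V \<partial>distr M N p)"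
  proof (rule nn_integral_mono)
    fix x assume "x \<in> space (distr M N p)"
    then have x: "x \<in> space N" by simp
    show "(\<integral>\<^sup>+y. ennreal (\<Phi> (x, y)) \<partial>distr M K w) \<le> ennreal V"
      using nn_integral_eq_integral[OF int[OF x]] nonneg le[OF x] by (simp add: ennreal_leI)
  qed
  also have "\<dots> = ennreal V"
    using P.emeasure_space_1 by simp
  finally have nn: "(\<integral>\<^sup>+\<omega>. ennreal (\<Phi> (p \<omega>, w \<omega>)) \<partial>M) \<le> ennreal V" .
  show *: "integrable M (\<lambda>\<omega>. \<Phi> (p \<omega>, w \<omega>))"
    by (rule integrableI_bounded) (use nn nonneg in \<open>auto simp: less_top[symmetric] top_unique\<close>)
  show "(\<integral>\<omega>. \<Phi> (p \<omega>, w \<omega>) \<partial>M) \<le> V"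
    using nn V nonneg by (subst (asm) nn_integral_eq_integral[OF *]) auto
qed

text \<open>
  The corresponding lower bound, which may depend on \<open>p\<close>; the integrand has no fixed sign here, so
  that Fubini's theorem needs its integrability.
\<close>

lemma (in prob_space) indep_pair_integral_ge:
  fixes \<Phi> :: "'b \<times> 'c \<Rightarrow> real"
  assumes indep: "indep_pair N p K w" and \<Phi> [measurable]: "\<Phi> \<in> borel_measurable (N \<Otimes>\<^sub>M K)"
    and c [measurable]: "c \<in> borel_measurable N"
    and int: "integrable M (\<lambda>\<omega>. \<Phi> (p \<omega>, w \<omega>))" and int_c: "integrable M (\<lambda>\<omega>. c (p \<omega>))"
    and ge: "\<And>x. x \<in> space N \<Longrightarrow> c x \<le> (\<integral>y. \<Phi> (x, y) \<partial>distr M K w)"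
  shows "(\<integral>\<omega>. c (p \<omega>) \<partial>M) \<le> (\<integral>\<omega>. \<Phi> (p \<omega>, w \<omega>) \<partial>M)"
proof -
  have rv [measurable]: "random_variable N p" "random_variable K w"
    by (fact indep_pair_measurable[OF indep])+
  interpret P: prob_space "distr M N p" by (rule prob_space_distr) simp
  interpret Q: prob_space "distr M K w" by (rule prob_space_distr) simp
  interpret PQ: pair_sigma_finite "distr M N p" "distr M K w" ..
  have joint: "distr M (N \<Otimes>\<^sub>M K) (\<lambda>\<omega>. (p \<omega>, w \<omega>)) = distr M N p \<Otimes>\<^sub>M distr M K w"
    by (rule distr_indep_pair[OF indep])
  have "integrable (distr M (N \<Otimes>\<^sub>M K) (\<lambda>\<omega>. (p \<omega>, w \<omega>))) \<Phi>"
    using int by (simp add: integrable_distr_eq)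
  then have int': "integrable (distr M N p \<Otimes>\<^sub>M distr M K w) \<Phi>"
    unfolding joint .
  have "(\<integral>\<omega>. c (p \<omega>) \<partial>M) = (\<integral>x. c x \<partial>distr M N p)"
    by (simp add: integral_distr)
  also have "\<dots> \<le> (\<integral>x. \<integral>y. \<Phi> (x, y) \<partial>distr M K w \<partial>distr M N p)"
    by (rule integral_mono[OF _ PQ.integrable_fst'[OF int']]) (use int_c ge in \<open>auto simp: integrable_distr_eq\<close>)
  also have "\<dots> = (\<integral>z. \<Phi> z \<partial>(distr M N p \<Otimes>\<^sub>M distr M K w))"
    by (rule PQ.integral_fst'[OF int'])
  also have "\<dots> = (\<integral>\<omega>. \<Phi> (p \<omega>, w \<omega>) \<partial>M)"
    unfolding joint[symmetric] by (simp add: integral_distr)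
  finally show ?thesis .
qed

section \<open>Noisy observations in a random direction\<close>

locale noisy_convex_objective = P: prob_space P for P :: "'b measure" +
  fixes F :: "real ^ 'n \<Rightarrow> 'b \<Rightarrow> real" and f :: "real ^ 'n \<Rightarrow> real" and L \<sigma> c \<alpha> :: real
  assumes F_measurable: "(\<lambda>(y, z). F y z) \<in> borel_measurable (borel \<Otimes>\<^sub>M P)"
    and F_integrable: "\<And>y. integrable P (F y)"
    and f_eq: "\<And>y. f y = (\<integral>z. F y z \<partial>P)"
    and f_convex: "convex_on UNIV f"
    and L_pos: "L > 0" and f_lipschitz: "L-lipschitz_on UNIV f"
    and noise_integrable: "\<And>y. integrable P (\<lambda>z. (F y z - f y)\<^sup>2)"
    and noise_variance: "\<And>y. (\<integral>z. (F y z - f y)\<^sup>2 \<partial>P) \<le> \<sigma>\<^sup>2"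
    and fourth_moment: "sphere_fourth_moment_const c"
    and \<alpha>_pos: "\<alpha> > 0"
begin

text \<open>
  The joint law of a direction and a noise sample.
\<close>

definition oracle_measure :: "((real ^ 'n) \<times> 'b) measure" where
  "oracle_measure = unif_sphere \<Otimes>\<^sub>M P"

definition evaluation :: "real ^ 'n \<Rightarrow> (real ^ 'n) \<times> 'b \<Rightarrow> real" where
  "evaluation y w = F (y + \<alpha> *\<^sub>R fst w) (snd w)"

definition smoothed :: "real ^ 'n \<Rightarrow> real" where
  "smoothed y = (\<integral>u. f (y + \<alpha> *\<^sub>R u) \<partial>unif_sphere)"

definition evaluation_variance :: real where
  "evaluation_variance = \<sigma>\<^sup>2 + c * (L * \<alpha>)\<^sup>2 / real CARD('n)"

sublocale U: prob_space "unif_sphere :: (real ^ 'n) measure"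
  by (rule prob_space_unif_sphere)

sublocale UP: pair_prob_space "unif_sphere :: (real ^ 'n) measure" P ..

lemma sets_oracle_measure [measurable_cong, simp]: "sets oracle_measure = sets (borel \<Otimes>\<^sub>M P)"
  unfolding oracle_measure_def by (intro sets_pair_measure_cong) simp_all

lemma f_measurable [measurable]: "f \<in> borel_measurable borel"
  by (rule lipschitz_on_borel_measurable[OF f_lipschitz])

lemma F_measurable_compose [measurable]:
  assumes [measurable]: "a \<in> borel_measurable M" "b \<in> M \<rightarrow>\<^sub>M P"
  shows "(\<lambda>x. F (a x) (b x)) \<in> borel_measurable M"
  using measurable_compose[OF measurable_Pair[OF assms] F_measurable] by simp

lemma evaluation_measurable [measurable]:
  assumes [measurable]: "a \<in> borel_measurable M" "b \<in> M \<rightarrow>\<^sub>M borel \<Otimes>\<^sub>M P"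
  shows "(\<lambda>x. evaluation (a x) (b x)) \<in> borel_measurable M"
  unfolding evaluation_def by measurable

lemma query_lipschitz: "(L * \<alpha>)-lipschitz_on UNIV (\<lambda>u. f (y + \<alpha> *\<^sub>R u))"
proof (rule lipschitz_onI)
  fix u v :: "real ^ 'n"
  have "\<bar>f (y + \<alpha> *\<^sub>R u) - f (y + \<alpha> *\<^sub>R v)\<bar> \<le> L * norm (\<alpha> *\<^sub>R (u - v))"
    using lipschitz_on_abs_diff_le[OF f_lipschitz, of "y + \<alpha> *\<^sub>R u" "y + \<alpha> *\<^sub>R v"]
    by (simp add: scaleR_right_diff_distrib)
  then show "dist (f (y + \<alpha> *\<^sub>R u)) (f (y + \<alpha> *\<^sub>R v)) \<le> L * \<alpha> * dist u v"
    using \<alpha>_pos by (simp add: dist_norm)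
qed (use L_pos \<alpha>_pos in simp)

lemma query_convex: "convex_on UNIV (\<lambda>u. f (y + \<alpha> *\<^sub>R u))"
proof (rule convex_onI)
  fix t :: real and u v :: "real ^ 'n"
  assume "t > 0" "t < 1"
  have "y + \<alpha> *\<^sub>R ((1 - t) *\<^sub>R u + t *\<^sub>R v) = (1 - t) *\<^sub>R (y + \<alpha> *\<^sub>R u) + t *\<^sub>R (y + \<alpha> *\<^sub>R v)"
    by (simp add: algebra_simps)
  then show "f (y + \<alpha> *\<^sub>R ((1 - t) *\<^sub>R u + t *\<^sub>R v)) \<le> (1 - t) * f (y + \<alpha> *\<^sub>R u) + t * f (y + \<alpha> *\<^sub>R v)"
    using \<open>t > 0\<close> \<open>t < 1\<close> convex_onD[OF f_convex, of t] by simp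
qed simp

lemma query_integrable: "integrable unif_sphere (\<lambda>u. f (y + \<alpha> *\<^sub>R u))"
proof (rule integrable_unif_sphere)
  show "\<bar>f (y + \<alpha> *\<^sub>R u)\<bar> \<le> \<bar>f y\<bar> + L * \<alpha>" if "norm u = 1" for u
    using lipschitz_on_abs_diff_le[OF f_lipschitz, of "y + \<alpha> *\<^sub>R u" y] that \<alpha>_pos by simp
qed measurable

lemma smoothed_lipschitz: "L-lipschitz_on UNIV smoothed"
proof (rule lipschitz_onI)
  fix y y' :: "real ^ 'n"
  have "smoothed y - smoothed y' = (\<integral>u. f (y + \<alpha> *\<^sub>R u) - f (y' + \<alpha> *\<^sub>R u) \<partial>unif_sphere)"
    unfolding smoothed_def by (simp add: query_integrable)
  also have "\<bar>\<dots>\<bar> \<le> (\<integral>u. \<bar>f (y + \<alpha> *\<^sub>R u) - f (y' + \<alpha> *\<^sub>R u)\<bar> \<partial>unif_sphere)"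
    by (rule integral_abs_bound)
  also have "\<dots> \<le> (\<integral>u. L * norm (y - y') \<partial>(unif_sphere :: (real ^ 'n) measure))"
  proof (rule integral_mono)
    show "\<bar>f (y + \<alpha> *\<^sub>R u) - f (y' + \<alpha> *\<^sub>R u)\<bar> \<le> L * norm (y - y')" for u
      using lipschitz_on_abs_diff_le[OF f_lipschitz, of "y + \<alpha> *\<^sub>R u" "y' + \<alpha> *\<^sub>R u"] by simp
  qed (simp_all add: query_integrable)
  finally show "dist (smoothed y) (smoothed y') \<le> L * dist y y'"
    using U.prob_space by (simp add: dist_norm)
qed (use L_pos in simp)

lemma smoothed_measurable [measurable]: "smoothed \<in> borel_measurable borel"
  by (rule lipschitz_on_borel_measurable[OF smoothed_lipschitz])

text \<open>
  Bias-variance decomposition: the noise has mean zero around \<open>f y\<close>.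
\<close>

lemma noise_second_moment:
  shows "integrable P (\<lambda>z. (F y z - r)\<^sup>2)"
    and "(\<integral>z. (F y z - r)\<^sup>2 \<partial>P) \<le> \<sigma>\<^sup>2 + (f y - r)\<^sup>2"
proof -
  have eq: "(\<lambda>z. (F y z - r)\<^sup>2) = (\<lambda>z. (F y z - f y)\<^sup>2 + (2 * (f y - r) * (F y z - f y) + (f y - r)\<^sup>2))"
    by (simp add: fun_eq_iff power2_eq_square algebra_simps)
  show "integrable P (\<lambda>z. (F y z - r)\<^sup>2)"
    unfolding eq using F_integrable[of y] noise_integrable[of y] by simp
  have "(\<integral>z. (F y z - r)\<^sup>2 \<partial>P) = (\<integral>z. (F y z - f y)\<^sup>2 \<partial>P) + (2 * (f y - r) * ((\<integral>z. F y z \<partial>P) - f y) + (f y - r)\<^sup>2)"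
    unfolding eq using F_integrable[of y] noise_integrable[of y] P.prob_space by simp
  then show "(\<integral>z. (F y z - r)\<^sup>2 \<partial>P) \<le> \<sigma>\<^sup>2 + (f y - r)\<^sup>2"
    using noise_variance[of y] by (simp add: f_eq[symmetric])
qed

text \<open>
  Given the direction the noise contributes at most \<open>\<sigma>\<^sup>2\<close>, and the dependence on the direction
  contributes the variance of an \<open>L * \<alpha>\<close>-Lipschitz function on the sphere.
\<close>

lemma evaluation_second_moment:
  shows "integrable oracle_measure (\<lambda>w. (evaluation y w - smoothed y)\<^sup>2)"
    and "(\<integral>w. (evaluation y w - smoothed y)\<^sup>2 \<partial>oracle_measure) \<le> evaluation_variance"
proof -
  let ?h = "smoothed y"
  have var: "(\<integral>u. (f (y + \<alpha> *\<^sub>R u) - ?h)\<^sup>2 \<partial>unif_sphere) \<le> c * (L * \<alpha>)\<^sup>2 / real CARD('n)"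
    unfolding smoothed_def
    by (rule unif_sphere_variance_le[OF fourth_moment _ query_lipschitz]) (use L_pos \<alpha>_pos in simp)
  have int_sq: "integrable unif_sphere (\<lambda>u. (f (y + \<alpha> *\<^sub>R u) - ?h)\<^sup>2)"
  proof (rule integrable_unif_sphere)
    fix u :: "real ^ 'n" assume "norm u = 1"
    then have "\<bar>f (y + \<alpha> *\<^sub>R u) - ?h\<bar> \<le> \<bar>f y - ?h\<bar> + L * \<alpha>"
      using lipschitz_on_abs_diff_le[OF f_lipschitz, of "y + \<alpha> *\<^sub>R u" y] \<alpha>_pos by simp
    then have "(f (y + \<alpha> *\<^sub>R u) - ?h)\<^sup>2 \<le> (\<bar>f y - ?h\<bar> + L * \<alpha>)\<^sup>2"
      by (rule abs_le_square_iff[THEN iffD1, OF order_trans]) simp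
    then show "\<bar>(f (y + \<alpha> *\<^sub>R u) - ?h)\<^sup>2\<bar> \<le> (\<bar>f y - ?h\<bar> + L * \<alpha>)\<^sup>2"
      by simp
  qed measurable
  have "(\<integral>\<^sup>+w. ennreal ((evaluation y w - ?h)\<^sup>2) \<partial>oracle_measure) =
      (\<integral>\<^sup>+u. \<integral>\<^sup>+z. ennreal ((F (y + \<alpha> *\<^sub>R u) z - ?h)\<^sup>2) \<partial>P \<partial>unif_sphere)"
    unfolding oracle_measure_def evaluation_def by (subst P.nn_integral_fst[symmetric]) simp_all
  also have "\<dots> \<le> (\<integral>\<^sup>+u. ennreal (\<sigma>\<^sup>2 + (f (y + \<alpha> *\<^sub>R u) - ?h)\<^sup>2) \<partial>unif_sphere)"
    using noise_second_moment[where r = ?h]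
    by (intro nn_integral_mono, subst nn_integral_eq_integral) (auto intro!: ennreal_leI simp del: ennreal_plus)
  also have "\<dots> = ennreal (\<integral>u. \<sigma>\<^sup>2 + (f (y + \<alpha> *\<^sub>R u) - ?h)\<^sup>2 \<partial>unif_sphere)"
    by (rule nn_integral_eq_integral) (simp_all add: int_sq)
  also have "(\<integral>u. \<sigma>\<^sup>2 + (f (y + \<alpha> *\<^sub>R u) - ?h)\<^sup>2 \<partial>unif_sphere) =
      \<sigma>\<^sup>2 + (\<integral>u. (f (y + \<alpha> *\<^sub>R u) - ?h)\<^sup>2 \<partial>unif_sphere)"
    using int_sq U.prob_space by simp
  also have "ennreal \<dots> \<le> ennreal evaluation_variance"
    unfolding evaluation_variance_def using var by (intro ennreal_leI) simp
  finally have nn: "(\<integral>\<^sup>+w. ennreal ((evaluation y w - ?h)\<^sup>2) \<partial>oracle_measure) \<le> ennreal evaluation_variance" .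
  show int: "integrable oracle_measure (\<lambda>w. (evaluation y w - ?h)\<^sup>2)"
    by (rule integrableI_bounded) (use nn in \<open>auto simp: less_top[symmetric] top_unique\<close>)
  have "0 \<le> (\<integral>u. (f (y + \<alpha> *\<^sub>R u) - ?h)\<^sup>2 \<partial>unif_sphere)" by simp
  then have "0 \<le> evaluation_variance"
    using var unfolding evaluation_variance_def by (smt (verit) zero_le_power2)
  then show "(\<integral>w. (evaluation y w - ?h)\<^sup>2 \<partial>oracle_measure) \<le> evaluation_variance"
    using nn by (subst (asm) nn_integral_eq_integral[OF int]) auto
qed

lemma AE_oracle_measure_norm: "AE w in oracle_measure. norm (fst w) = 1"
  unfolding oracle_measure_def
proof (rule UP.AE_pair_measure)
  show "AE u in unif_sphere. AE z in P. norm (fst (u, z)) = 1"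
    using AE_unif_sphere_norm by eventually_elim simp
qed measurable

text \<open>
  The gradient estimate is biased towards descent by at most \<open>\<alpha> * L\<close>. Any constant \<open>r\<close> may be
  subtracted from the observation because the direction has mean zero; in the algorithm \<open>r\<close> is the
  previous observation.
\<close>

lemma evaluation_direction_inequality:
  "f y - f y' - \<alpha> * L \<le>
    real CARD('n) / \<alpha> * (\<integral>w. (evaluation y w - r) * (fst w \<bullet> (y - y')) \<partial>oracle_measure)"
proof -
  interpret Q: prob_space oracle_measure
    unfolding oracle_measure_def by unfold_locales
  have "integrable oracle_measure (\<lambda>w. evaluation y w - smoothed y)"
    by (rule Q.square_integrable_imp_integrable[OF _ evaluation_second_moment(1)]) measurable
  from Bochner_Integration.integrable_add[OF this Q.integrable_const[of "smoothed y - r"]]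
  have int_eval: "integrable oracle_measure (\<lambda>w. evaluation y w - r)"
    by simp
  have int: "integrable oracle_measure (\<lambda>w. (evaluation y w - r) * (fst w \<bullet> (y - y')))"
  proof (rule Bochner_Integration.integrable_bound)
    show "integrable oracle_measure (\<lambda>w. (evaluation y w - r) * norm (y - y'))"
      using int_eval by simp
    show "AE w in oracle_measure. norm ((evaluation y w - r) * (fst w \<bullet> (y - y'))) \<le> norm ((evaluation y w - r) * norm (y - y'))"
      using AE_oracle_measure_norm
    proof eventually_elim
      case (elim w)
      then show ?case
        using Cauchy_Schwarz_ineq2[of "fst w" "y - y'"] by (auto simp: abs_mult intro!: mult_left_mono)
    qed
  qed measurable
  have "(\<integral>w. (evaluation y w - r) * (fst w \<bullet> (y - y')) \<partial>oracle_measure) =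
      (\<integral>u. \<integral>z. (F (y + \<alpha> *\<^sub>R u) z - r) * (u \<bullet> (y - y')) \<partial>P \<partial>unif_sphere)"
    using UP.integral_fst'[OF int[unfolded oracle_measure_def]]
    by (simp add: oracle_measure_def evaluation_def)
  also have "\<dots> = (\<integral>u. f (y + \<alpha> *\<^sub>R u) * (u \<bullet> (y - y')) - r * (u \<bullet> (y - y')) \<partial>unif_sphere)"
    using F_integrable P.prob_space by (simp add: f_eq left_diff_distrib)
  also have "\<dots> = (\<integral>u. f (y + \<alpha> *\<^sub>R u) * (u \<bullet> (y - y')) \<partial>unif_sphere)"
  proof (subst Bochner_Integration.integral_diff)
    have le: "\<bar>u \<bullet> (y - y')\<bar> \<le> norm (y - y')" if "norm u = 1" for u
      using Cauchy_Schwarz_ineq2[of u "y - y'"] that by simp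
    then have "integrable unif_sphere (\<lambda>u. u \<bullet> (y - y'))"
      by (intro integrable_unif_sphere) auto
    then show "integrable unif_sphere (\<lambda>u. r * (u \<bullet> (y - y')))" by simp
    have "\<bar>f (y + \<alpha> *\<^sub>R u)\<bar> \<le> \<bar>f y\<bar> + L * \<alpha>" if "norm u = 1" for u
      using lipschitz_on_abs_diff_le[OF f_lipschitz, of "y + \<alpha> *\<^sub>R u" y] that \<alpha>_pos by simp
    with le show "integrable unif_sphere (\<lambda>u. f (y + \<alpha> *\<^sub>R u) * (u \<bullet> (y - y')))"
      by (intro integrable_unif_sphere[of _ "(\<bar>f y\<bar> + L * \<alpha>) * norm (y - y')"])
        (auto simp: abs_mult less_imp_le[OF L_pos] less_imp_le[OF \<alpha>_pos] intro!: mult_mono)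
  qed (simp add: integral_unif_sphere_inner)
  finally have eq: "(\<integral>w. (evaluation y w - r) * (fst w \<bullet> (y - y')) \<partial>oracle_measure) =
      (\<integral>u. f (y + \<alpha> *\<^sub>R u) * (u \<bullet> (y - y')) \<partial>unif_sphere)" .
  \<comment> \<open>the displacement \<open>(y - y') / \<alpha>\<close> makes \<open>y'\<close> the value of the rescaled argument at \<open>- w\<close>\<close>
  have "f (y + \<alpha> *\<^sub>R 0) - f (y + \<alpha> *\<^sub>R - ((1 / \<alpha>) *\<^sub>R (y - y'))) - L * \<alpha> \<le>
      real CARD('n) * (\<integral>u. f (y + \<alpha> *\<^sub>R u) * (u \<bullet> ((1 / \<alpha>) *\<^sub>R (y - y'))) \<partial>unif_sphere)"
    by (rule sphere_gradient_inequality[OF query_convex query_lipschitz])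
  also have "(\<integral>u. f (y + \<alpha> *\<^sub>R u) * (u \<bullet> ((1 / \<alpha>) *\<^sub>R (y - y'))) \<partial>unif_sphere) =
      1 / \<alpha> * (\<integral>u. f (y + \<alpha> *\<^sub>R u) * (u \<bullet> (y - y')) \<partial>unif_sphere)"
    by (subst integral_mult_right_zero[symmetric]) (simp add: ac_simps)
  finally show ?thesis
    unfolding eq using \<alpha>_pos by (simp add: mult.commute)
qed

end

section \<open>Displacements of the iterates\<close>

lemma square_sum3_le: "(a - b + r)\<^sup>2 \<le> 3 * (a\<^sup>2 + b\<^sup>2 + r\<^sup>2)" for a b r :: real
proof -
  have "3 * (a\<^sup>2 + b\<^sup>2 + r\<^sup>2) - (a - b + r)\<^sup>2 = (a + b)\<^sup>2 + (a - r)\<^sup>2 + (b + r)\<^sup>2"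
    by (simp add: power2_eq_square algebra_simps)
  then show ?thesis
    using sum_power2_ge_zero[of "a + b" "a - r"] zero_le_power2[of "b + r"] by linarith
qed

text \<open>
  The pairs of a direction and a noise sample are treated as one independent, identically distributed
  sequence.
\<close>

locale residual_feedback_run = noisy_convex_objective P F f L \<sigma> c \<alpha> + \<Omega>: prob_space \<Omega>
  for P :: "'b measure" and F :: "real ^ 'n \<Rightarrow> 'b \<Rightarrow> real" and f :: "real ^ 'n \<Rightarrow> real"
    and L \<sigma> c \<alpha> :: real and \<Omega> :: "'w measure" +
  fixes sample :: "nat \<Rightarrow> 'w \<Rightarrow> (real ^ 'n) \<times> 'b" and T :: nat and \<eta> :: real and x1 :: "real ^ 'n"
  assumes samples_indep: "\<Omega>.indep_vars (\<lambda>_. borel \<Otimes>\<^sub>M P) sample {..T}"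
    and samples_distr: "\<And>t. t \<le> T \<Longrightarrow> distr \<Omega> (borel \<Otimes>\<^sub>M P) (sample t) = oracle_measure"
    and \<eta>_pos: "\<eta> > 0"
begin

text \<open>
  The iterates as a deterministic function of the sequence of samples, so that their dependence on
  the past alone and their measurability can be expressed on the product space of the samples.
\<close>

definition trajectory :: "(nat \<Rightarrow> (real ^ 'n) \<times> 'b) \<Rightarrow> nat \<Rightarrow> real ^ 'n" where
  "trajectory p = residual_iterate F \<eta> \<alpha> x1 (\<lambda>s. fst (p s)) (\<lambda>s. snd (p s))"

text \<open>
  A step moves the iterate by \<open>gain\<close> times the difference of the last two observations.
\<close>

definition gain :: real where
  "gain = \<eta> * real CARD('n) / \<alpha>"

lemma gain_pos: "gain > 0"
  using \<eta>_pos \<alpha>_pos by (simp add: gain_def)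

lemma trajectory_0 [simp]: "trajectory p 0 = x1"
  and trajectory_1 [simp]: "trajectory p (Suc 0) = x1"
  by (simp_all add: trajectory_def)

lemma trajectory_Suc:
  assumes "t \<ge> 1"
  shows "trajectory p (Suc t) = trajectory p t -
    (gain * (evaluation (trajectory p t) (p t) - evaluation (trajectory p (t - 1)) (p (t - 1)))) *\<^sub>R fst (p t)"
proof -
  obtain s where t: "t = Suc s" using assms by (cases t) auto
  show ?thesis
    unfolding t by (simp add: trajectory_def residual_gradient_def evaluation_def gain_def)
qed

lemma trajectory_cong:
  "(\<And>s. s < t \<Longrightarrow> p s = q s) \<Longrightarrow> trajectory p t = trajectory q t"
proof (induction t rule: less_induct)
  case (less t)
  show ?case
  proof (cases "t \<le> 1")
    case True
    then show ?thesis by (cases t) auto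
  next
    case False
    then obtain s where t: "t = Suc s" "s \<ge> 1" by (cases t) auto
    have "trajectory p s = trajectory q s" "trajectory p (s - 1) = trajectory q (s - 1)"
      using less t by auto
    moreover have "p s = q s" "p (s - 1) = q (s - 1)"
      using less.prems t by auto
    ultimately show ?thesis
      unfolding t(1) trajectory_Suc[OF t(2)] by simp
  qed
qed

lemma trajectory_measurable [measurable]:
  "{..<t} \<subseteq> J \<Longrightarrow> (\<lambda>p. trajectory p t) \<in> borel_measurable (\<Pi>\<^sub>M s\<in>J. borel \<Otimes>\<^sub>M P)"
proof (induction t rule: less_induct)
  case (less t)
  show ?case
  proof (cases "t \<le> 1")
    case True
    then show ?thesis by (cases t) auto
  next
    case False
    then obtain s where t: "t = Suc s" "s \<ge> 1" by (cases t) auto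
    have [measurable]: "(\<lambda>p. trajectory p s) \<in> borel_measurable (\<Pi>\<^sub>M s\<in>J. borel \<Otimes>\<^sub>M P)"
      "(\<lambda>p. trajectory p (s - 1)) \<in> borel_measurable (\<Pi>\<^sub>M s\<in>J. borel \<Otimes>\<^sub>M P)"
      using less.prems t by (auto intro!: less.IH simp: subset_iff)
    have [measurable]: "(\<lambda>p. p s) \<in> (\<Pi>\<^sub>M s\<in>J. borel \<Otimes>\<^sub>M P) \<rightarrow>\<^sub>M borel \<Otimes>\<^sub>M P"
      "(\<lambda>p. p (s - 1)) \<in> (\<Pi>\<^sub>M s\<in>J. borel \<Otimes>\<^sub>M P) \<rightarrow>\<^sub>M borel \<Otimes>\<^sub>M P"
      using less.prems t by (auto intro!: measurable_component_singleton simp: subset_iff)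
    show ?thesis
      unfolding t(1) trajectory_Suc[OF t(2)] by measurable
  qed
qed

definition past :: "nat \<Rightarrow> 'w \<Rightarrow> nat \<Rightarrow> (real ^ 'n) \<times> 'b" where
  "past t \<omega> = (\<lambda>s\<in>{..<t}. sample s \<omega>)"

definition iterate :: "nat \<Rightarrow> 'w \<Rightarrow> real ^ 'n" where
  "iterate t \<omega> = trajectory (\<lambda>s. sample s \<omega>) t"

definition observation :: "nat \<Rightarrow> 'w \<Rightarrow> real" where
  "observation t \<omega> = evaluation (iterate t \<omega>) (sample t \<omega>)"

lemma iterate_eq_past: "s \<le> t \<Longrightarrow> iterate s \<omega> = trajectory (past t \<omega>) s"
  unfolding iterate_def past_def by (rule trajectory_cong) auto

lemma iterate_0: "iterate 0 \<omega> = x1" and iterate_1: "iterate (Suc 0) \<omega> = x1"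
  by (simp_all add: iterate_def)

lemma iterate_Suc:
  "t \<ge> 1 \<Longrightarrow> iterate (Suc t) \<omega> = iterate t \<omega> -
    (gain * (observation t \<omega> - observation (t - 1) \<omega>)) *\<^sub>R fst (sample t \<omega>)"
  unfolding iterate_def observation_def by (rule trajectory_Suc)

lemma sample_measurable [measurable]: "t \<le> T \<Longrightarrow> sample t \<in> \<Omega> \<rightarrow>\<^sub>M borel \<Otimes>\<^sub>M P"
  using samples_indep by (auto simp: \<Omega>.indep_vars_def)

lemma past_measurable [measurable]: "t \<le> Suc T \<Longrightarrow> past t \<in> \<Omega> \<rightarrow>\<^sub>M (\<Pi>\<^sub>M s\<in>{..<t}. borel \<Otimes>\<^sub>M P)"
  unfolding past_def by (rule measurable_restrict) auto

lemma iterate_measurable [measurable]: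
  assumes "t \<le> Suc T" shows "iterate t \<in> borel_measurable \<Omega>"
proof -
  have "(\<lambda>\<omega>. trajectory (past t \<omega>) t) \<in> borel_measurable \<Omega>"
    using measurable_compose[OF past_measurable[OF assms] trajectory_measurable] by simp
  then show ?thesis by (simp add: iterate_eq_past[symmetric])
qed

lemma observation_measurable [measurable]: "t \<le> T \<Longrightarrow> observation t \<in> borel_measurable \<Omega>"
  unfolding observation_def by measurable

text \<open>
  The fresh sample is independent of everything that determines the current iterate.
\<close>

lemma past_indep_sample:
  assumes "t \<le> T"
  shows "\<Omega>.indep_pair (\<Pi>\<^sub>M s\<in>{..<t}. borel \<Otimes>\<^sub>M P) (past t) (borel \<Otimes>\<^sub>M P) (sample t)"
proof -
  have "\<Omega>.indep_var (\<Pi>\<^sub>M s\<in>{..<t}. borel \<Otimes>\<^sub>M P) (past t) (\<Pi>\<^sub>M s\<in>{t}. borel \<Otimes>\<^sub>M P) (\<lambda>\<omega>. \<lambda>s\<in>{t}. sample s \<omega>)"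
    unfolding past_def by (rule \<Omega>.indep_var_restrict[OF samples_indep]) (use assms in auto)
  from \<Omega>.indep_pair_compose[OF \<Omega>.indep_pair_if_indep_var[OF this] measurable_ident measurable_component_singleton[of t]]
  show ?thesis by simp
qed

lemma AE_sample_norm:
  assumes "t \<le> T" shows "AE \<omega> in \<Omega>. norm (fst (sample t \<omega>)) = 1"
proof -
  have "AE w in distr \<Omega> (borel \<Otimes>\<^sub>M P) (sample t). norm (fst w) = 1"
    unfolding samples_distr[OF assms] by (rule AE_oracle_measure_norm)
  then show ?thesis
    using assms by (subst (asm) AE_distr_iff) auto
qed

lemma observation_second_moment:
  assumes t: "t \<le> T"
  shows "integrable \<Omega> (\<lambda>\<omega>. (observation t \<omega> - smoothed (iterate t \<omega>))\<^sup>2)"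
    and "(\<integral>\<omega>. (observation t \<omega> - smoothed (iterate t \<omega>))\<^sup>2 \<partial>\<Omega>) \<le> evaluation_variance"
proof -
  let ?N = "\<Pi>\<^sub>M s\<in>{..<t}. borel \<Otimes>\<^sub>M P"
  let ?\<Phi> = "\<lambda>(p, w). (evaluation (trajectory p t) w - smoothed (trajectory p t))\<^sup>2"
  have [measurable]: "(\<lambda>p. trajectory p t) \<in> borel_measurable ?N"
    by (rule trajectory_measurable) simp
  have "integrable \<Omega> (\<lambda>\<omega>. ?\<Phi> (past t \<omega>, sample t \<omega>)) \<and>
    (\<integral>\<omega>. ?\<Phi> (past t \<omega>, sample t \<omega>) \<partial>\<Omega>) \<le> evaluation_variance"
    using evaluation_second_moment
    by (intro conjI \<Omega>.indep_pair_integral_le[OF past_indep_sample[OF t], of ?\<Phi>])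
      (auto simp: samples_distr[OF t])
  then show "integrable \<Omega> (\<lambda>\<omega>. (observation t \<omega> - smoothed (iterate t \<omega>))\<^sup>2)"
    "(\<integral>\<omega>. (observation t \<omega> - smoothed (iterate t \<omega>))\<^sup>2 \<partial>\<Omega>) \<le> evaluation_variance"
    by (simp_all add: observation_def iterate_eq_past[of t t])
qed

text \<open>
  The residual is the difference of the deviations of two observations from the smoothed objective,
  plus the change of the smoothed objective between the two iterates. The deviations have second moment
  at most \<open>evaluation_variance\<close>, and the change is at most \<open>L\<close> times the preceding displacement. The
  resulting recursion \<open>b \<mapsto> 2/3 * B + 1/3 * b\<close> keeps the bound \<open>B\<close>, and it starts at \<open>0\<close>
  because the iterates \<open>0\<close> and \<open>1\<close> coincide.
\<close>

lemma displacement_second_moment: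
  assumes B: "gain\<^sup>2 * (6 * evaluation_variance) \<le> 2 / 3 * B" and contraction: "gain\<^sup>2 * (3 * L\<^sup>2) \<le> 1 / 3"
    and "t \<le> T"
  shows "integrable \<Omega> (\<lambda>\<omega>. (norm (iterate (Suc t) \<omega> - iterate t \<omega>))\<^sup>2) \<and>
    (\<integral>\<omega>. (norm (iterate (Suc t) \<omega> - iterate t \<omega>))\<^sup>2 \<partial>\<Omega>) \<le> B"
  using \<open>t \<le> T\<close>
proof (induction t)
  case 0
  have "0 \<le> (\<integral>\<omega>. (observation 0 \<omega> - smoothed (iterate 0 \<omega>))\<^sup>2 \<partial>\<Omega>)" by simp
  then have "0 \<le> evaluation_variance"
    using observation_second_moment(2)[of 0] by linarith
  then have "0 \<le> gain\<^sup>2 * (6 * evaluation_variance)" by simp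
  then show ?case using B by (simp add: iterate_0 iterate_1)
next
  case (Suc t)
  let ?Y = "\<lambda>t \<omega>. observation t \<omega> - smoothed (iterate t \<omega>)"
  let ?R = "\<lambda>\<omega>. gain\<^sup>2 * (3 * ((?Y (Suc t) \<omega>)\<^sup>2 + (?Y t \<omega>)\<^sup>2 + L\<^sup>2 * (norm (iterate (Suc t) \<omega> - iterate t \<omega>))\<^sup>2))"
  have IH: "integrable \<Omega> (\<lambda>\<omega>. (norm (iterate (Suc t) \<omega> - iterate t \<omega>))\<^sup>2)"
      "(\<integral>\<omega>. (norm (iterate (Suc t) \<omega> - iterate t \<omega>))\<^sup>2 \<partial>\<Omega>) \<le> B"
    using Suc by auto
  have Y: "integrable \<Omega> (\<lambda>\<omega>. (?Y s \<omega>)\<^sup>2)" "(\<integral>\<omega>. (?Y s \<omega>)\<^sup>2 \<partial>\<Omega>) \<le> evaluation_variance" if "s \<le> Suc t" for s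
    using observation_second_moment[of s] Suc.prems that by auto
  have int_R: "integrable \<Omega> ?R"
    using IH(1) Y(1)[of t] Y(1)[of "Suc t"] by simp
  have le_R: "AE \<omega> in \<Omega>. (norm (iterate (Suc (Suc t)) \<omega> - iterate (Suc t) \<omega>))\<^sup>2 \<le> ?R \<omega>"
    using AE_sample_norm[OF Suc.prems]
  proof eventually_elim
    case (elim \<omega>)
    let ?r = "smoothed (iterate (Suc t) \<omega>) - smoothed (iterate t \<omega>)"
    have "\<bar>?r\<bar> \<le> L * norm (iterate (Suc t) \<omega> - iterate t \<omega>)"
      by (rule lipschitz_on_abs_diff_le[OF smoothed_lipschitz])
    then have r: "?r\<^sup>2 \<le> L\<^sup>2 * (norm (iterate (Suc t) \<omega> - iterate t \<omega>))\<^sup>2"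
      using power_mono[of "\<bar>?r\<bar>" _ 2] by (fastforce simp: power_mult_distrib)
    have "norm (iterate (Suc (Suc t)) \<omega> - iterate (Suc t) \<omega>) =
        gain * \<bar>observation (Suc t) \<omega> - observation t \<omega>\<bar>"
      using elim gain_pos by (simp add: iterate_Suc abs_mult)
    then have "(norm (iterate (Suc (Suc t)) \<omega> - iterate (Suc t) \<omega>))\<^sup>2 =
        gain\<^sup>2 * (?Y (Suc t) \<omega> - ?Y t \<omega> + ?r)\<^sup>2"
      by (simp add: power_mult_distrib)
    also have "\<dots> \<le> gain\<^sup>2 * (3 * ((?Y (Suc t) \<omega>)\<^sup>2 + (?Y t \<omega>)\<^sup>2 + ?r\<^sup>2))"
      by (intro mult_left_mono square_sum3_le) simp
    also have "\<dots> \<le> ?R \<omega>"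
      using r by (intro mult_left_mono add_left_mono) auto
    finally show ?case .
  qed
  have [measurable]: "iterate (Suc t) \<in> borel_measurable \<Omega>" "iterate (Suc (Suc t)) \<in> borel_measurable \<Omega>"
    using Suc.prems by (auto intro!: iterate_measurable)
  have int: "integrable \<Omega> (\<lambda>\<omega>. (norm (iterate (Suc (Suc t)) \<omega> - iterate (Suc t) \<omega>))\<^sup>2)"
    by (rule Bochner_Integration.integrable_bound[OF int_R]) (use le_R in \<open>auto elim!: eventually_mono\<close>)
  have "(\<integral>\<omega>. (norm (iterate (Suc (Suc t)) \<omega> - iterate (Suc t) \<omega>))\<^sup>2 \<partial>\<Omega>) \<le> (\<integral>\<omega>. ?R \<omega> \<partial>\<Omega>)"
    by (rule integral_mono_AE[OF int int_R le_R])
  also have "\<dots> = gain\<^sup>2 * (3 * ((\<integral>\<omega>. (?Y (Suc t) \<omega>)\<^sup>2 \<partial>\<Omega>) + (\<integral>\<omega>. (?Y t \<omega>)\<^sup>2 \<partial>\<Omega>) +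
      L\<^sup>2 * (\<integral>\<omega>. (norm (iterate (Suc t) \<omega> - iterate t \<omega>))\<^sup>2 \<partial>\<Omega>)))"
    using IH(1) Y(1)[of t] Y(1)[of "Suc t"] by simp
  also have "\<dots> \<le> gain\<^sup>2 * (3 * (evaluation_variance + evaluation_variance + L\<^sup>2 * B))"
    using IH(2) Y(2)[of t] Y(2)[of "Suc t"]
    by (intro mult_left_mono add_mono) auto
  also have "\<dots> = gain\<^sup>2 * (6 * evaluation_variance) + (gain\<^sup>2 * (3 * L\<^sup>2)) * B"
    by (simp add: algebra_simps)
  also have "\<dots> \<le> 2 / 3 * B + 1 / 3 * B"
  proof (intro add_mono B mult_right_mono contraction)
    have "0 \<le> (\<integral>\<omega>. (norm (iterate (Suc t) \<omega> - iterate t \<omega>))\<^sup>2 \<partial>\<Omega>)" by simp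
    then show "0 \<le> B" using IH(2) by linarith
  qed
  also have "\<dots> = B" by simp
  finally show ?case using int by simp
qed

end

section \<open>Expected descent\<close>

context residual_feedback_run
begin

lemma distance_square_integrable:
  assumes steps: "\<And>t. t \<le> T \<Longrightarrow> integrable \<Omega> (\<lambda>\<omega>. (norm (iterate (Suc t) \<omega> - iterate t \<omega>))\<^sup>2)"
  shows "t \<le> Suc T \<Longrightarrow> integrable \<Omega> (\<lambda>\<omega>. (norm (iterate t \<omega> - a))\<^sup>2)"
proof (induction t)
  case 0
  then show ?case by (simp add: iterate_0)
next
  case (Suc t)
  have [measurable]: "iterate (Suc t) \<in> borel_measurable \<Omega>"
    using Suc.prems by (rule iterate_measurable)
  show ?case
  proof (rule Bochner_Integration.integrable_bound)
    show "integrable \<Omega> (\<lambda>\<omega>. 2 * (norm (iterate t \<omega> - a))\<^sup>2 + 2 * (norm (iterate (Suc t) \<omega> - iterate t \<omega>))\<^sup>2)"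
      using Suc steps by simp
    show "AE \<omega> in \<Omega>. norm ((norm (iterate (Suc t) \<omega> - a))\<^sup>2) \<le>
        norm (2 * (norm (iterate t \<omega> - a))\<^sup>2 + 2 * (norm (iterate (Suc t) \<omega> - iterate t \<omega>))\<^sup>2)"
    proof (rule AE_I2)
      fix \<omega>
      let ?a = "norm (iterate t \<omega> - a)" and ?b = "norm (iterate (Suc t) \<omega> - iterate t \<omega>)"
      have "norm (iterate (Suc t) \<omega> - a) \<le> ?a + ?b"
        using norm_triangle_ineq[of "iterate t \<omega> - a" "iterate (Suc t) \<omega> - iterate t \<omega>"] by simp
      then have "(norm (iterate (Suc t) \<omega> - a))\<^sup>2 \<le> (?a + ?b)\<^sup>2"
        by (intro power_mono) auto
      also have "\<dots> \<le> 2 * ?a\<^sup>2 + 2 * ?b\<^sup>2"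
        using zero_le_power2[of "?a - ?b"] by (simp add: power2_eq_square algebra_simps)
      finally show "norm ((norm (iterate (Suc t) \<omega> - a))\<^sup>2) \<le> norm (2 * ?a\<^sup>2 + 2 * ?b\<^sup>2)"
        by simp
    qed
  qed simp
qed

lemma suboptimality_integrable:
  assumes steps: "\<And>t. t \<le> T \<Longrightarrow> integrable \<Omega> (\<lambda>\<omega>. (norm (iterate (Suc t) \<omega> - iterate t \<omega>))\<^sup>2)"
    and t: "t \<le> Suc T"
  shows "integrable \<Omega> (\<lambda>\<omega>. f (iterate t \<omega>) - f a)"
proof -
  have [measurable]: "iterate t \<in> borel_measurable \<Omega>"
    using t by (rule iterate_measurable)
  have "integrable \<Omega> (\<lambda>\<omega>. norm (iterate t \<omega> - a))"
    by (rule \<Omega>.square_integrable_imp_integrable[OF _ distance_square_integrable[OF steps t]]) simp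
  then show ?thesis
    by (rule Bochner_Integration.integrable_bound[OF integrable_mult_right[of L]])
      (use lipschitz_on_abs_diff_le[OF f_lipschitz] L_pos in \<open>auto simp: abs_mult\<close>)
qed

text \<open>
  Expand the square of the distance after the step. The cross term is a multiple of the residual times
  the inner product of the direction with \<open>iterate t - a\<close>; given the past, its expectation is bounded by
  \<open>evaluation_direction_inequality\<close>, with the previous observation as the constant \<open>r\<close>.
\<close>

lemma expected_descent:
  assumes steps: "\<And>t. t \<le> T \<Longrightarrow> integrable \<Omega> (\<lambda>\<omega>. (norm (iterate (Suc t) \<omega> - iterate t \<omega>))\<^sup>2)"
    and t: "1 \<le> t" "t \<le> T"
  shows "2 * \<eta> * ((\<integral>\<omega>. f (iterate t \<omega>) - f a \<partial>\<Omega>) - \<alpha> * L) \<le>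
    (\<integral>\<omega>. (norm (iterate t \<omega> - a))\<^sup>2 \<partial>\<Omega>) - (\<integral>\<omega>. (norm (iterate (Suc t) \<omega> - a))\<^sup>2 \<partial>\<Omega>) +
    (\<integral>\<omega>. (norm (iterate (Suc t) \<omega> - iterate t \<omega>))\<^sup>2 \<partial>\<Omega>)"
proof -
  let ?N = "\<Pi>\<^sub>M s\<in>{..<t}. borel \<Otimes>\<^sub>M P"
  \<comment> \<open>\<open>\<Phi>\<close> is the residual inner product, \<open>C\<close> its lower bound given the past, \<open>S\<close> the cross term\<close>
  define \<Phi> where "\<Phi> = (\<lambda>(p, w). (evaluation (trajectory p t) w - evaluation (trajectory p (t - 1)) (p (t - 1))) *
    (fst w \<bullet> (trajectory p t - a)))"
  define C where "C p = \<alpha> / real CARD('n) * (f (trajectory p t) - f a - \<alpha> * L)" for p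
  define S where "S \<omega> = (iterate (Suc t) \<omega> - iterate t \<omega>) \<bullet> (iterate t \<omega> - a)" for \<omega>
  have [measurable]: "(\<lambda>p. trajectory p t) \<in> borel_measurable ?N" "(\<lambda>p. trajectory p (t - 1)) \<in> borel_measurable ?N"
    by (auto intro!: trajectory_measurable)
  have [measurable]: "(\<lambda>p. p (t - 1)) \<in> ?N \<rightarrow>\<^sub>M borel \<Otimes>\<^sub>M P"
    using t by (intro measurable_component_singleton) auto
  have [measurable]: "iterate t \<in> borel_measurable \<Omega>" "iterate (Suc t) \<in> borel_measurable \<Omega>"
    using t by (auto intro!: iterate_measurable)
  have \<Phi>_meas: "\<Phi> \<in> borel_measurable (?N \<Otimes>\<^sub>M (borel \<Otimes>\<^sub>M P))"
    unfolding \<Phi>_def by measurable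
  have C_meas: "C \<in> borel_measurable ?N"
    unfolding C_def by measurable
  have \<Phi>_past: "\<Phi> (past t \<omega>, sample t \<omega>) = (observation t \<omega> - observation (t - 1) \<omega>) * (fst (sample t \<omega>) \<bullet> (iterate t \<omega> - a))" for \<omega>
  proof -
    have "past t \<omega> (t - 1) = sample (t - 1) \<omega>" using t by (simp add: past_def)
    then show ?thesis
      using t by (simp add: \<Phi>_def observation_def iterate_eq_past[of t t] iterate_eq_past[of "t - Suc 0" t])
  qed
  have S_eq: "S \<omega> = - gain * \<Phi> (past t \<omega>, sample t \<omega>)" for \<omega>
    unfolding S_def \<Phi>_past iterate_Suc[OF t(1)] by simp
  note dist_int = distance_square_integrable[OF steps, where a = a]
  have S_int: "integrable \<Omega> S"
  proof (rule Bochner_Integration.integrable_bound)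
    show "integrable \<Omega> (\<lambda>\<omega>. (norm (iterate (Suc t) \<omega> - iterate t \<omega>))\<^sup>2 + (norm (iterate t \<omega> - a))\<^sup>2)"
      using steps[of t] dist_int[of t] t by simp
    show "AE \<omega> in \<Omega>. norm (S \<omega>) \<le> norm ((norm (iterate (Suc t) \<omega> - iterate t \<omega>))\<^sup>2 + (norm (iterate t \<omega> - a))\<^sup>2)"
    proof (rule AE_I2)
      fix \<omega>
      let ?x = "norm (iterate (Suc t) \<omega> - iterate t \<omega>)" and ?y = "norm (iterate t \<omega> - a)"
      have "\<bar>S \<omega>\<bar> \<le> ?x * ?y" unfolding S_def by (rule Cauchy_Schwarz_ineq2)
      also have "\<dots> \<le> ?x\<^sup>2 + ?y\<^sup>2"
      proof -
        have "0 \<le> ?x * ?y" by simp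
        with sum_squares_bound[of ?x ?y] show ?thesis by (simp only: mult.assoc)
      qed
      finally show "norm (S \<omega>) \<le> norm (?x\<^sup>2 + ?y\<^sup>2)" by simp
    qed
  qed (simp add: S_def[abs_def])
  have \<Phi>_int: "integrable \<Omega> (\<lambda>\<omega>. \<Phi> (past t \<omega>, sample t \<omega>))"
  proof -
    have "(\<lambda>\<omega>. \<Phi> (past t \<omega>, sample t \<omega>)) = (\<lambda>\<omega>. S \<omega> / (- gain))"
      using gain_pos by (simp add: S_eq fun_eq_iff)
    then show ?thesis using S_int by simp
  qed
  have f_int: "integrable \<Omega> (\<lambda>\<omega>. f (iterate t \<omega>) - f a)"
    by (rule suboptimality_integrable[OF steps]) (use t in auto)
  have C_past: "C (past t \<omega>) = \<alpha> / real CARD('n) * ((f (iterate t \<omega>) - f a) - \<alpha> * L)" for \<omega>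
    by (simp add: C_def iterate_eq_past[of t t])
  have C_int: "integrable \<Omega> (\<lambda>\<omega>. C (past t \<omega>))"
    unfolding C_past by (intro integrable_mult_right Bochner_Integration.integrable_diff f_int) simp
  have "(\<integral>\<omega>. C (past t \<omega>) \<partial>\<Omega>) \<le> (\<integral>\<omega>. \<Phi> (past t \<omega>, sample t \<omega>) \<partial>\<Omega>)"
  proof (rule \<Omega>.indep_pair_integral_ge[where p = "past t" and w = "sample t" and c = C and \<Phi> = \<Phi>, OF past_indep_sample[OF t(2)] \<Phi>_meas C_meas \<Phi>_int C_int])
    fix p
    show "C p \<le> (\<integral>w. \<Phi> (p, w) \<partial>distr \<Omega> (borel \<Otimes>\<^sub>M P) (sample t))"
      using evaluation_direction_inequality[of "trajectory p t" a "evaluation (trajectory p (t - 1)) (p (t - 1))"] \<alpha>_pos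
      unfolding samples_distr[OF t(2)] C_def \<Phi>_def by (simp add: field_simps)
  qed
  moreover have "(\<integral>\<omega>. C (past t \<omega>) \<partial>\<Omega>) = \<alpha> / real CARD('n) * ((\<integral>\<omega>. f (iterate t \<omega>) - f a \<partial>\<Omega>) - \<alpha> * L)"
    unfolding C_past integral_mult_right_zero
    using \<Omega>.prob_space by (subst Bochner_Integration.integral_diff[OF f_int]) auto
  ultimately have "gain * (\<alpha> / real CARD('n) * ((\<integral>\<omega>. f (iterate t \<omega>) - f a \<partial>\<Omega>) - \<alpha> * L)) \<le>
      gain * (\<integral>\<omega>. \<Phi> (past t \<omega>, sample t \<omega>) \<partial>\<Omega>)"
    using gain_pos by (intro mult_left_mono) auto
  also have "\<dots> = - (\<integral>\<omega>. S \<omega> \<partial>\<Omega>)"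
    unfolding S_eq by simp
  finally have descent: "\<eta> * ((\<integral>\<omega>. f (iterate t \<omega>) - f a \<partial>\<Omega>) - \<alpha> * L) \<le> - (\<integral>\<omega>. S \<omega> \<partial>\<Omega>)"
    using \<alpha>_pos by (simp add: gain_def)
  have "(norm (iterate (Suc t) \<omega> - a))\<^sup>2 =
      (norm (iterate t \<omega> - a))\<^sup>2 + 2 * S \<omega> + (norm (iterate (Suc t) \<omega> - iterate t \<omega>))\<^sup>2" for \<omega>
    unfolding S_def power2_norm_eq_inner by (simp add: algebra_simps inner_commute)
  then have "(\<integral>\<omega>. (norm (iterate (Suc t) \<omega> - a))\<^sup>2 \<partial>\<Omega>) =
      (\<integral>\<omega>. (norm (iterate t \<omega> - a))\<^sup>2 \<partial>\<Omega>) + 2 * (\<integral>\<omega>. S \<omega> \<partial>\<Omega>) +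
      (\<integral>\<omega>. (norm (iterate (Suc t) \<omega> - iterate t \<omega>))\<^sup>2 \<partial>\<Omega>)"
    using S_int dist_int[of t] steps[of t] t by simp
  then show ?thesis using descent by linarith
qed

lemma average_suboptimality_le:
  assumes B: "gain\<^sup>2 * (6 * evaluation_variance) \<le> 2 / 3 * B" and contraction: "gain\<^sup>2 * (3 * L\<^sup>2) \<le> 1 / 3"
  shows "t \<le> T \<Longrightarrow> integrable \<Omega> (\<lambda>\<omega>. f (iterate t \<omega>) - f a)"
    and "2 * \<eta> * ((\<Sum>t=1..T. \<integral>\<omega>. f (iterate t \<omega>) - f a \<partial>\<Omega>) - real T * (\<alpha> * L)) \<le> (norm (x1 - a))\<^sup>2 + real T * B"
proof -
  note step = displacement_second_moment[OF B contraction]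
  have steps: "integrable \<Omega> (\<lambda>\<omega>. (norm (iterate (Suc t) \<omega> - iterate t \<omega>))\<^sup>2)" if "t \<le> T" for t
    using step[OF that] by simp
  show "integrable \<Omega> (\<lambda>\<omega>. f (iterate t \<omega>) - f a)" if "t \<le> T"
    by (rule suboptimality_integrable[OF steps]) (use that in auto)
  define D where "D t = (\<integral>\<omega>. (norm (iterate t \<omega> - a))\<^sup>2 \<partial>\<Omega>)" for t
  have "(\<Sum>t=1..T. 2 * \<eta> * ((\<integral>\<omega>. f (iterate t \<omega>) - f a \<partial>\<Omega>) - \<alpha> * L)) \<le> (\<Sum>t=1..T. - (D (Suc t) - D t) + B)"
  proof (rule sum_mono)
    fix t assume "t \<in> {1..T}"
    then show "2 * \<eta> * ((\<integral>\<omega>. f (iterate t \<omega>) - f a \<partial>\<Omega>) - \<alpha> * L) \<le> - (D (Suc t) - D t) + B"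
      using expected_descent[OF steps, of t a] step[of t] by (simp add: D_def)
  qed
  also have "\<dots> = D 1 - D (Suc T) + real T * B"
    unfolding sum.distrib sum_negf using sum_Suc_diff[of 1 T D] by simp
  also have "\<dots> \<le> (norm (x1 - a))\<^sup>2 + real T * B"
    using \<Omega>.prob_space by (simp add: D_def iterate_1)
  finally show "2 * \<eta> * ((\<Sum>t=1..T. \<integral>\<omega>. f (iterate t \<omega>) - f a \<partial>\<Omega>) - real T * (\<alpha> * L)) \<le> (norm (x1 - a))\<^sup>2 + real T * B"
    by (simp add: sum_subtractf sum_distrib_left[symmetric] right_diff_distrib mult.left_commute)
qed

end

section \<open>Step size, smoothing parameter and number of iterations\<close>

lemma smoothing_parameter_power4:
  fixes \<alpha> d \<sigma> D L :: real
  assumes "d \<ge> 0" "\<sigma> \<ge> 0" "D \<ge> 0" "L > 0" "T \<ge> 1"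
    and \<alpha>: "\<alpha> = 96 powr (1/4) * sqrt d * sqrt \<sigma> * sqrt D / (sqrt L * real T powr (1/4))"
  shows "\<alpha> ^ 4 * L\<^sup>2 * real T = 96 * d\<^sup>2 * \<sigma>\<^sup>2 * D\<^sup>2"
proof -
  have sqrt4: "sqrt a ^ 4 = a\<^sup>2" if "a \<ge> 0" for a
  proof -
    have "sqrt a ^ 4 = ((sqrt a)\<^sup>2)\<^sup>2" by (simp only: power_mult[symmetric]) simp
    then show ?thesis using that by simp
  qed
  have root4: "(a powr (1/4)) ^ 4 = a" if "a > 0" for a :: real
    using that by (simp add: powr_power)
  have "\<alpha> ^ 4 = 96 * d\<^sup>2 * \<sigma>\<^sup>2 * D\<^sup>2 / (L\<^sup>2 * real T)"
    unfolding \<alpha> power_divide power_mult_distrib using assms by (simp add: sqrt4 root4)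
  then show ?thesis using assms by simp
qed

text \<open>
  The remaining estimates concern the parameters only: \<open>D\<close> stands for the initial distance to the
  minimizer, and \<open>S / d\<close> for the variance of an observation.
\<close>

context
  fixes c d D L \<sigma> \<epsilon> \<alpha> \<eta> S :: real and T :: nat
  assumes pos: "c > 0" "d > 0" "D > 0" "L > 0" "\<sigma> > 0" "\<epsilon> > 0" "\<alpha> > 0" "T \<ge> 1"
    and \<alpha>4: "\<alpha> ^ 4 * L\<^sup>2 * real T = 96 * d\<^sup>2 * \<sigma>\<^sup>2 * D\<^sup>2"
    and S: "S = c * L\<^sup>2 * \<alpha>\<^sup>2 + d * \<sigma>\<^sup>2"
    and \<eta>: "\<eta> = D * \<alpha> / (sqrt (24 * d * real T) * sqrt S)"
begin

lemma S_pos: "S > 0"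
  using pos by (simp add: S add_pos_pos)

lemma gain_squared: "(\<eta> * d / \<alpha>)\<^sup>2 = d * D\<^sup>2 / (24 * real T * S)"
proof -
  have "\<eta> * d / \<alpha> = d * D / (sqrt (24 * d * real T) * sqrt S)"
    using pos by (simp add: \<eta>)
  then have "(\<eta> * d / \<alpha>)\<^sup>2 = d\<^sup>2 * D\<^sup>2 / (24 * d * real T * S)"
    using pos S_pos by (simp add: power_divide power_mult_distrib)
  then show ?thesis
    using pos by (simp add: power2_eq_square)
qed

lemma gain_variance: "(\<eta> * d / \<alpha>)\<^sup>2 * (6 * (\<sigma>\<^sup>2 + c * (L * \<alpha>)\<^sup>2 / d)) = 2 / 3 * (3 / 8 * D\<^sup>2 / real T)"
proof -
  have "\<sigma>\<^sup>2 + c * (L * \<alpha>)\<^sup>2 / d = S / d"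
    using pos by (simp add: S field_simps)
  then show ?thesis
    unfolding gain_squared using pos S_pos by (simp add: field_simps)
qed

text \<open>
  Since \<open>S \<ge> c * L\<^sup>2 * \<alpha>\<^sup>2\<close>, it suffices that \<open>3 * d * D\<^sup>2 \<le> 8 * T * c * \<alpha>\<^sup>2\<close>. Squaring this and
  substituting the value of \<open>\<alpha> ^ 4\<close> gives exactly the assumed lower bound on \<open>T\<close>.
\<close>

lemma gain_contraction:
  assumes T_cond: "3 * L\<^sup>2 * D\<^sup>2 / (2 ^ 11 * c\<^sup>2 * \<sigma>\<^sup>2) \<le> real T"
  shows "(\<eta> * d / \<alpha>)\<^sup>2 * (3 * L\<^sup>2) \<le> 1 / 3"
proof -
  have T_cond': "3 * L\<^sup>2 * D\<^sup>2 \<le> 2048 * c\<^sup>2 * \<sigma>\<^sup>2 * real T"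
    using T_cond pos by (simp add: field_simps)
  have "(3 * d * D\<^sup>2)\<^sup>2 * L\<^sup>2 = 3 * d\<^sup>2 * D\<^sup>2 * (3 * L\<^sup>2 * D\<^sup>2)"
    by (simp add: power2_eq_square)
  also have "\<dots> \<le> 3 * d\<^sup>2 * D\<^sup>2 * (2048 * c\<^sup>2 * \<sigma>\<^sup>2 * real T)"
    by (rule mult_left_mono[OF T_cond']) simp
  also have "\<dots> = 64 * c\<^sup>2 * real T * (96 * d\<^sup>2 * \<sigma>\<^sup>2 * D\<^sup>2)"
    by simp
  also have "\<dots> = (8 * real T * c * \<alpha>\<^sup>2)\<^sup>2 * L\<^sup>2"
    unfolding \<alpha>4[symmetric] by (simp add: power2_eq_square power4_eq_xxxx)
  finally have "(3 * d * D\<^sup>2)\<^sup>2 \<le> (8 * real T * c * \<alpha>\<^sup>2)\<^sup>2"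
    using pos by simp
  then have "3 * d * D\<^sup>2 \<le> 8 * real T * c * \<alpha>\<^sup>2"
    by (rule power2_le_imp_le) (use pos in simp)
  from mult_right_mono[OF this, of "L\<^sup>2"]
  have "3 * d * D\<^sup>2 * L\<^sup>2 \<le> 8 * real T * (c * L\<^sup>2 * \<alpha>\<^sup>2)"
    by (simp add: ac_simps)
  also have "\<dots> \<le> 8 * real T * S"
    using pos by (intro mult_left_mono) (simp_all add: S)
  finally show ?thesis
    unfolding gain_squared using pos S_pos by (simp add: field_simps)
qed

text \<open>
  The first term of the maximum gives \<open>\<alpha> * L \<le> \<epsilon> / 2\<close>. The square of \<open>X = D\<^sup>2 / (\<eta> * T)\<close> is
  \<open>24 * d * c * L\<^sup>2 * D\<^sup>2 / T + (\<alpha> * L)\<^sup>2 / 4\<close>, by the second term of the maximum and the bound on \<open>\<alpha> * L\<close> at most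
  \<open>\<epsilon>\<^sup>2 / 4 + \<epsilon>\<^sup>2 / 16\<close>, which is below \<open>(9/16 * \<epsilon>)\<^sup>2\<close>; and \<open>1/2 + 11/16 * 9/16 < 1\<close>.
\<close>

lemma accuracy:
  assumes T_large: "96 * L\<^sup>2 * D\<^sup>2 * max (16 * d\<^sup>2 * \<sigma>\<^sup>2 / \<epsilon> ^ 4) (d * c / \<epsilon>\<^sup>2) \<le> real T"
  shows "\<alpha> * L + 11 / 16 * (D\<^sup>2 / (\<eta> * real T)) \<le> \<epsilon>"
proof -
  have "96 * L\<^sup>2 * D\<^sup>2 * (16 * d\<^sup>2 * \<sigma>\<^sup>2 / \<epsilon> ^ 4) \<le> real T" "96 * L\<^sup>2 * D\<^sup>2 * (d * c / \<epsilon>\<^sup>2) \<le> real T"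
    by (rule order_trans[OF mult_left_mono T_large]; simp)+
  then have T1: "96 * L\<^sup>2 * D\<^sup>2 * (16 * d\<^sup>2 * \<sigma>\<^sup>2) \<le> real T * \<epsilon> ^ 4"
    and T2: "96 * L\<^sup>2 * D\<^sup>2 * (d * c) \<le> real T * \<epsilon>\<^sup>2"
    using pos by (simp_all add: field_simps)
  have "(\<alpha> * L) ^ 4 * real T = L\<^sup>2 * (96 * d\<^sup>2 * \<sigma>\<^sup>2 * D\<^sup>2)"
    unfolding \<alpha>4[symmetric] by (simp add: power2_eq_square power4_eq_xxxx)
  also have "\<dots> \<le> (\<epsilon> / 2) ^ 4 * real T"
    using T1 by (simp add: power_divide field_simps)
  finally have "(\<alpha> * L) ^ 4 \<le> (\<epsilon> / 2) ^ 4"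
    using pos by simp
  then have bias: "\<alpha> * L \<le> \<epsilon> / 2"
    by (subst (asm) power_mono_iff) (use pos in auto)
  define X where "X = D\<^sup>2 / (\<eta> * real T)"
  have "X\<^sup>2 * (\<alpha>\<^sup>2 * real T) = 24 * d * D\<^sup>2 * S"
  proof -
    have "\<eta> * real T * X = D\<^sup>2"
      using pos S_pos by (simp add: X_def \<eta>)
    then have "(\<eta> * real T * X)\<^sup>2 = D ^ 4" by simp
    moreover have "(\<eta> * real T * X)\<^sup>2 = D\<^sup>2 * \<alpha>\<^sup>2 / (24 * d * real T * S) * (real T)\<^sup>2 * X\<^sup>2"
      using pos S_pos by (simp add: \<eta> power_mult_distrib power_divide)
    ultimately have "D\<^sup>2 * \<alpha>\<^sup>2 / (24 * d * real T * S) * (real T)\<^sup>2 * X\<^sup>2 = D ^ 4"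
      by simp
    then have "D\<^sup>2 * (X\<^sup>2 * (\<alpha>\<^sup>2 * real T)) = D\<^sup>2 * (24 * d * D\<^sup>2 * S)"
      using pos S_pos by (simp add: field_simps power2_eq_square power4_eq_xxxx)
    then show ?thesis using pos by simp
  qed
  also have "24 * d * D\<^sup>2 * S = \<alpha>\<^sup>2 * (24 * d * D\<^sup>2 * c * L\<^sup>2) + 24 * d\<^sup>2 * \<sigma>\<^sup>2 * D\<^sup>2"
    by (simp add: S power2_eq_square algebra_simps)
  also have "24 * d\<^sup>2 * \<sigma>\<^sup>2 * D\<^sup>2 = \<alpha>\<^sup>2 * ((\<alpha> * L)\<^sup>2 / 4 * real T)"
    using \<alpha>4 by (simp add: power2_eq_square power4_eq_xxxx ac_simps)
  also have "\<alpha>\<^sup>2 * (24 * d * D\<^sup>2 * c * L\<^sup>2) + \<alpha>\<^sup>2 * ((\<alpha> * L)\<^sup>2 / 4 * real T) \<le>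
      \<alpha>\<^sup>2 * (real T * \<epsilon>\<^sup>2 / 4) + \<alpha>\<^sup>2 * ((\<epsilon> / 2)\<^sup>2 / 4 * real T)"
    using T2 bias pos by (intro add_mono mult_left_mono mult_right_mono divide_right_mono power_mono) (simp_all add: ac_simps)
  also have "\<dots> = (5 / 16 * \<epsilon>\<^sup>2) * (\<alpha>\<^sup>2 * real T)"
    by (simp add: power2_eq_square)
  also have "\<dots> \<le> (9 / 16 * \<epsilon>)\<^sup>2 * (\<alpha>\<^sup>2 * real T)"
    by (intro mult_right_mono) (simp_all add: power_mult_distrib power_divide)
  finally have "X\<^sup>2 \<le> (9 / 16 * \<epsilon>)\<^sup>2"
    using pos by simp
  then have "X \<le> 9 / 16 * \<epsilon>"
    by (rule power2_le_imp_le) (use pos in simp)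
  then show ?thesis
    using bias pos unfolding X_def by linarith
qed

end

section \<open>Sample complexity\<close>

theorem corollary12:
  fixes P :: "'b measure"
    and F :: "real ^ 'n \<Rightarrow> 'b \<Rightarrow> real"
    and f :: "real ^ 'n \<Rightarrow> real"
    and x1 xstar :: "real ^ 'n"
    and L0 \<sigma>0 c0 \<eta> \<alpha> \<epsilon> d :: real
    and T :: nat
    and \<Omega> :: "'w measure"
    and u :: "nat \<Rightarrow> 'w \<Rightarrow> real ^ 'n"
    and \<xi> :: "nat \<Rightarrow> 'w \<Rightarrow> 'b"
    and x :: "nat \<Rightarrow> 'w \<Rightarrow> real ^ 'n"
  assumes d: "d = real CARD('n)"
    and c0: "c0 > 0" "sphere_fourth_moment_const c0"
    \<comment> \<open>the objective; \<open>P\<close> is the distribution of the random variable \<open>\<xi>\<close>\<close>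
    and P: "prob_space P"
    and F_measurable: "(\<lambda>(y, z). F y z) \<in> borel_measurable (borel \<Otimes>\<^sub>M P)"
    and F_integrable: "\<And>y. integrable P (F y)"
    and f: "\<And>y. f y = (\<integral>z. F y z \<partial>P)"
    and convex: "convex_on UNIV f"
    and lipschitz: "L0 > 0" "L0-lipschitz_on UNIV f"
    and minimizer: "\<And>y. f xstar \<le> f y"
    and \<sigma>0: "\<sigma>0 > 0"
    and variance_integrable: "\<And>y. integrable P (\<lambda>z. (F y z - f y)\<^sup>2)"
    and variance: "\<And>y. (\<integral>z. (F y z - f y)\<^sup>2 \<partial>P) \<le> \<sigma>0\<^sup>2"
    \<comment> \<open>the random directions and samples\<close>
    and \<Omega>: "prob_space \<Omega>"
    and u_distr: "\<And>t. t \<le> T \<Longrightarrow> distr \<Omega> borel (u t) = unif_sphere"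
    and u_indep: "prob_space.indep_vars \<Omega> (\<lambda>_. borel) u {..T}"
    and \<xi>_distr: "\<And>t. t \<le> T \<Longrightarrow> distr \<Omega> P (\<xi> t) = P"
    and \<xi>_indep: "prob_space.indep_vars \<Omega> (\<lambda>_. P) \<xi> {..T}"
    and u_\<xi>_indep: "prob_space.indep_set \<Omega>
          (sets (vimage_algebra (space \<Omega>) (\<lambda>\<omega>. \<lambda>t\<in>{..T}. u t \<omega>) (\<Pi>\<^sub>M t\<in>{..T}. borel)))
          (sets (vimage_algebra (space \<Omega>) (\<lambda>\<omega>. \<lambda>t\<in>{..T}. \<xi> t \<omega>) (\<Pi>\<^sub>M t\<in>{..T}. P)))"
    \<comment> \<open>the algorithm and its parameters\<close>
    and x: "\<And>t \<omega>. x t \<omega> = residual_iterate F \<eta> \<alpha> x1 (\<lambda>s. u s \<omega>) (\<lambda>s. \<xi> s \<omega>) t"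
    and T: "T \<ge> 1"
    and \<eta>_pos: "\<eta> > 0"
    and \<eta>: "\<eta> = norm (x1 - xstar) * \<alpha> /
              (sqrt (24 * d * real T) * sqrt (c0 * L0\<^sup>2 * \<alpha>\<^sup>2 + d * \<sigma>0\<^sup>2))"
    and \<alpha>_pos: "\<alpha> > 0"
    and \<alpha>: "\<alpha> = 96 powr (1/4) * sqrt d * sqrt \<sigma>0 * sqrt (norm (x1 - xstar)) /
              (sqrt L0 * real T powr (1/4))"
    and \<epsilon>: "\<epsilon> > 0"
    and T_cond: "real T \<ge> 3 * L0\<^sup>2 * (norm (x1 - xstar))\<^sup>2 / (2 ^ 11 * c0\<^sup>2 * \<sigma>0\<^sup>2)"
    and T_complexity: "real T \<ge> 96 * L0\<^sup>2 * (norm (x1 - xstar))\<^sup>2 *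
              max (16 * d\<^sup>2 * \<sigma>0\<^sup>2 / \<epsilon> ^ 4) (d * c0 / \<epsilon>\<^sup>2)"
  shows "(\<forall>t\<in>{1..T}. integrable \<Omega> (\<lambda>\<omega>. f (x t \<omega>) - f xstar)) \<and>
         1 / real T * (\<Sum>t=1..T. \<integral>\<omega>. (f (x t \<omega>) - f xstar) \<partial>\<Omega>) \<le> \<epsilon>"
proof -
  define D where "D = norm (x1 - xstar)"
  have "D \<noteq> 0"
    using \<alpha> \<alpha>_pos by (auto simp: D_def)
  then have D_pos: "D > 0" by (simp add: D_def)
  have d_pos: "d > 0" by (simp add: d)
  interpret \<Omega>: prob_space \<Omega> by (fact \<Omega>)
  interpret noisy_convex_objective P F f L0 \<sigma>0 c0 \<alpha>
    using P F_measurable F_integrable f convex lipschitz variance_integrable variance c0(2) \<alpha>_pos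
    by (intro noisy_convex_objective.intro noisy_convex_objective_axioms.intro)
  define sample where "sample t \<omega> = (u t \<omega>, \<xi> t \<omega>)" for t \<omega>
  have "\<And>t. t \<le> T \<Longrightarrow> u t \<in> \<Omega> \<rightarrow>\<^sub>M borel" "\<And>t. t \<le> T \<Longrightarrow> \<xi> t \<in> \<Omega> \<rightarrow>\<^sub>M P"
    using u_indep \<xi>_indep by (auto simp: \<Omega>.indep_vars_def)
  then have joint: "\<Omega>.indep_pair (\<Pi>\<^sub>M t\<in>{..T}. borel) (\<lambda>\<omega>. \<lambda>t\<in>{..T}. u t \<omega>) (\<Pi>\<^sub>M t\<in>{..T}. P) (\<lambda>\<omega>. \<lambda>t\<in>{..T}. \<xi> t \<omega>)"
    by (intro \<Omega>.indep_pair_if_indep_vimage_algebras u_\<xi>_indep measurable_restrict) auto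
  interpret residual_feedback_run P F f L0 \<sigma>0 c0 \<alpha> \<Omega> sample T \<eta> x1
  proof unfold_locales
    show "\<Omega>.indep_vars (\<lambda>_. borel \<Otimes>\<^sub>M P) sample {..T}"
      using \<Omega>.indep_vars_Pair[OF _ _ u_indep \<xi>_indep joint] by (simp add: sample_def[abs_def])
    show "distr \<Omega> (borel \<Otimes>\<^sub>M P) (sample t) = oracle_measure" if "t \<le> T" for t
      using \<Omega>.distr_Pair_indep_families[OF _ _ u_indep \<xi>_indep joint, of t] that
      by (simp add: sample_def[abs_def] u_distr \<xi>_distr oracle_measure_def)
  qed (fact \<eta>_pos)
  have x_eq: "x t = iterate t" for t
    by (simp add: fun_eq_iff x iterate_def trajectory_def sample_def)

  define S where "S = c0 * L0\<^sup>2 * \<alpha>\<^sup>2 + d * \<sigma>0\<^sup>2"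
  note parameters = c0(1) d_pos D_pos lipschitz(1) \<sigma>0 \<epsilon> \<alpha>_pos T
  have \<alpha>4: "\<alpha> ^ 4 * L0\<^sup>2 * real T = 96 * d\<^sup>2 * \<sigma>0\<^sup>2 * D\<^sup>2"
    by (rule smoothing_parameter_power4) (use parameters \<alpha> in \<open>auto simp: D_def\<close>)
  have \<eta>': "\<eta> = D * \<alpha> / (sqrt (24 * d * real T) * sqrt S)"
    using \<eta> by (simp add: D_def S_def)
  note bounds = parameters \<alpha>4 S_def \<eta>'
  \<comment> \<open>an equality, which is where the constant \<open>3/8\<close> comes from\<close>
  have variance_bound: "gain\<^sup>2 * (6 * evaluation_variance) \<le> 2 / 3 * (3 / 8 * D\<^sup>2 / real T)"
    using gain_variance[OF bounds] by (simp add: gain_def evaluation_variance_def d)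
  have contraction: "gain\<^sup>2 * (3 * L0\<^sup>2) \<le> 1 / 3"
    using gain_contraction[OF bounds] T_cond by (simp add: gain_def d D_def)
  note average = average_suboptimality_le[OF variance_bound contraction, where a = xstar, folded x_eq D_def]
  have "(\<Sum>t=1..T. \<integral>\<omega>. f (x t \<omega>) - f xstar \<partial>\<Omega>) \<le> real T * (\<alpha> * L0) + 11 / 16 * (D\<^sup>2 / \<eta>)"
    using average(2) \<eta>_pos T by (simp add: field_simps)
  then have "1 / real T * (\<Sum>t=1..T. \<integral>\<omega>. f (x t \<omega>) - f xstar \<partial>\<Omega>) \<le> \<alpha> * L0 + 11 / 16 * (D\<^sup>2 / (\<eta> * real T))"
    using \<eta>_pos T by (simp add: field_simps)
  also have "\<dots> \<le> \<epsilon>"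
    using accuracy[OF bounds] T_complexity by (simp add: D_def)
  finally show ?thesis using average(1) by auto
qed

end
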